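(* Let $\Sigma=\mathcal{I}(\Sigma_1,\dots,\Sigma_N)$ be the interconnected control system induced by $N$ control subsystems $\Sigma_i$ and the coupling matrix $M$. Suppose each $\Sigma_i$ admits an abstraction $\hat\Sigma_i$ and a corresponding practical storage function $V_i$ from $\hat\Sigma_i$ to $\Sigma_i$, with associated functions and matrices $\nu_i,\eta_i,\rho_i,\Delta_i,v_i,H_i,W_i,\hat W_i,X_i,X_i^{11},X_i^{12},X_i^{21},X_i^{22}$. Let $W:=\mathrm{diag}(W_1,\dots,W_N)$, $\hat W:=\mathrm{diag}(\hat W_1,\dots,\hat W_N)$, $H:=\mathrm{diag}(H_1,\dots,H_N)$, $\tilde q:=\sum_{i=1}^N q_{2i}$, and let $X(\mu_1X_1,\dots,\mu_NX_N)$ be the block matrix defined in the context. Suppose there are scalars $\mu'_i>0$, $i=1,\dots,N$, with $$\begin{bmatrix}WM\\ I_{\tilde q}\end{bmatrix}^TX(\mu'_1X_1,\dots,\mu'_NX_N)\begin{bmatrix}WM\\ I_{\tilde q}\end{bmatrix}\le0 .$$ Let $\hat M$ be a matrix of appropriate dimension for which the residual $$Y:=WMH-\hat W\hat M$$ is nonzero, and let $\hat\Sigma=\mathcal{I}(\hat\Sigma_1,\dots,\hat\Sigma_N)$ be the interconnection of the abstractions with coupling matrix $\hat M$. If there exist scalars $\mu_i>0$, $i=1,\dots,N$, and a matrix $Z=Z^T\ge0$ of appropriate dimension such that $$\begin{bmatrix}Y&WM\\ 0&I_{\tilde q}\end{bmatrix}^TX(\mu_1X_1,\dots,\mu_NX_N)\begin{bmatrix}Y&WM\\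 0&I_{\tilde q}\end{bmatrix}-\begin{bmatrix}Z&0\\ 0&0\end{bmatrix}\le0,$$ then $$V(x,\hat x):=\sum_{i=1}^N\mu_iV_i(x_i,\hat x_i)$$ is a practical simulation function from $\hat\Sigma$ to $\Sigma$. In particular, the function $\Delta$ in the definition of practical simulation function is given by $$\Delta(\hat x):=\begin{bmatrix}\hat h_{21}(\hat x_1)\\ \vdots\\ \hat h_{2N}(\hat x_N)\end{bmatrix}^TZ\begin{bmatrix}\hat h_{21}(\hat x_1)\\ \vdots\\ \hat h_{2N}(\hat x_N)\end{bmatrix}+\sum_{i=1}^N\mu_i\Delta_i(\hat x_i).$$
   Context: **Notation.** $\mathcal{K}$ is the set of continuous strictly increasing $\alpha:\mathbb{R}_{\ge0}\to\mathbb{R}_{\ge0}$ with $\alpha(0)=0$; $\mathcal{K}_\infty$ those with moreover $\alpha(s)\to\infty$ as $s\to\infty$. $\|\cdot\|$ is the Euclidean norm; $[x_1;\dots;x_N]$ denotes concatenation of vectors; $\mathrm{diag}$ is block-diagonal concatenation (of possibly non-square blocks); inequalities between symmetric matrices are in the semidefinite sense. **Control system and practical simulation function.** A control system $\Sigma=(\mathbb{R}^n,\mathbb{R}^m,f,\mathbb{R}^q,h)$ is $\dot\xi=f(\xi,\upsilon)$, $\zeta=h(\xi)$, $f$ locally Lipschitz. Given $\Sigma$ and $\hat\Sigma=(\mathbb{R}^{\hat n},\mathbb{R}^{\hat m},\hat f,\mathbb{R}^q,\hat h)$, a continuously differentiable $V:\mathbb{R}^n\times\mathbb{R}^{\hat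 n}\to\mathbb{R}_{\ge0}$ is a practical simulation function from $\hat\Sigma$ to $\Sigma$ with an associated interface $v:\mathbb{R}^n\times\mathbb{R}^{\hat n}\times\mathbb{R}^{\hat m}\to\mathbb{R}^m$ (locally Lipschitz) if there exist $\nu,\eta\in\mathcal{K}_\infty$, $\rho\in\mathcal{K}\cup\{0\}$, $\Delta:\mathbb{R}^{\hat n}\to\mathbb{R}_{\ge0}$ such that for all $x,\hat x,\hat u$: $\nu(\|h(x)-\hat h(\hat x)\|)\le V(x,\hat x)$ and $$\frac{\partial V(x,\hat x)}{\partial x}f(x,v(x,\hat x,\hat u))+\frac{\partial V(x,\hat x)}{\partial\hat x}\hat f(\hat x,\hat u)\le-\eta(V(x,\hat x))+\rho(\|\hat u\|)+\Delta(\hat x).$$ $V$ is called a practical simulation function if this holds for some interface $v$. **Control subsystem.** A control subsystem $\Sigma=(\mathbb{R}^n,\mathbb{R}^m,\mathbb{R}^p,f,\mathbb{R}^{q_1},\mathbb{R}^{q_2},h_1,h_2)$ is $\dot\xi=f(\xi,\upsilon,\omega)$, $\zeta_1=h_1(\xi)$, $\zeta_2=h_2(\xi)$ with external input $\upsilon\in\mathbb{R}^m$, internal input $\omega\in\mathbb{R}^p$, external output $\zeta_1\in\mathbb{R}^{q_1}$, internal output $\zeta_2\in\mathbb{R}^{q_2}$; $f$ and $h_2$ are locally Lipschitz. **Practical storage function.** Let $\hat\Sigma=(\mathbb{R}^{\hat n},\mathbb{R}^{\hat m},\mathbb{R}^{\hat p},\hat f,\mathbb{R}^{q_1},\mathbb{R}^{\hat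 q_2},\hat h_1,\hat h_2)$ be an abstraction of the subsystem $\Sigma$. A continuously differentiable $V:\mathbb{R}^n\times\mathbb{R}^{\hat n}\to\mathbb{R}_{\ge0}$ is a practical storage function from $\hat\Sigma$ to $\Sigma$, with locally Lipschitz $v:\mathbb{R}^n\times\mathbb{R}^{\hat n}\times\mathbb{R}^{\hat m}\to\mathbb{R}^m$ (the interface), if there exist $\nu,\eta\in\mathcal{K}_\infty$, $\rho\in\mathcal{K}\cup\{0\}$, $\Delta:\mathbb{R}^{\hat n}\to\mathbb{R}_{\ge0}$, matrices $W,\hat W,H$ of appropriate dimensions, and a matrix $X=X^T$ with conformal blocks $X^{11},X^{12},X^{21},X^{22}$, such that for all $x\in\mathbb{R}^n,\hat x\in\mathbb{R}^{\hat n},\hat u\in\mathbb{R}^{\hat m},w\in\mathbb{R}^p,\hat w\in\mathbb{R}^{\hat p}$: $\nu(\|h_1(x)-\hat h_1(\hat x)\|)\le V(x,\hat x)$ and $$\frac{\partial V}{\partial x}f(x,v(x,\hat x,\hat u),w)+\frac{\partial V}{\partial\hat x}\hat f(\hat x,\hat u,\hat w)\le-\eta(V(x,\hat x))+\rho(\|\hat u\|)+\Delta(\hat x)+\begin{bmatrix}Ww-\hat W\hat w\\ h_2(x)-H\hat h_2(\hat x)\end{bmatrix}^T\begin{bmatrix}X^{11}&X^{12}\\ X^{21}&X^{22}\end{bmatrix}\begin{bmatrix}Ww-\hat W\hat w\\ h_2(x)-H\hat h_2(\hat x)\end{bmatrix}.$$ **Interconnection.** Given subsystems $\Sigma_i=(\mathbb{R}^{n_i},\mathbb{R}^{m_i},\mathbb{R}^{p_i},f_i,\mathbb{R}^{q_{1i}},\mathbb{R}^{q_{2i}},h_{1i},h_{2i})$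 and a static coupling matrix $M$, $\mathcal{I}(\Sigma_1,\dots,\Sigma_N)$ is the control system with state $x=[x_1;\dots;x_N]$, input $u=[u_1;\dots;u_N]$, $f(x,u)=[f_1(x_1,u_1,w_1);\dots;f_N(x_N,u_N,w_N)]$, $h(x)=[h_{11}(x_1);\dots;h_{1N}(x_N)]$, where $[w_1;\dots;w_N]=M[h_{21}(x_1);\dots;h_{2N}(x_N)]$. The system $\hat\Sigma$ is formed in the same way from the $\hat\Sigma_i$ and $\hat M$; $\hat h_{2i}$ denotes the internal output map of $\hat\Sigma_i$. **Block matrix.** $$X(\mu_1X_1,\dots,\mu_NX_N):=\begin{bmatrix}\mathrm{diag}(\mu_1X_1^{11},\dots,\mu_NX_N^{11})&\mathrm{diag}(\mu_1X_1^{12},\dots,\mu_NX_N^{12})\\ \mathrm{diag}(\mu_1X_1^{21},\dots,\mu_NX_N^{21})&\mathrm{diag}(\mu_1X_1^{22},\dots,\mu_NX_N^{22})\end{bmatrix}.$$ *)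

theory Defs
  imports "HOL-Analysis.Lipschitz" "HOL-Analysis.L2_Norm" "Jordan_Normal_Form.Matrix"
begin

no_notation inner (infix "\<bullet>" 70)

section \<open>Euclidean structure on dynamically sized vectors\<close>

text \<open>
  The space \<open>\<real>\<^sup>n\<close> is \<open>carrier_vec n\<close>, since the dimensions of the subsystems vary with the
  index of the subsystem. The metric below restricts to the Euclidean one on each \<open>carrier_vec n\<close>
  and puts vectors of different dimensions at distance at least 1.
\<close>

definition vec_norm :: "'a::real_normed_vector vec \<Rightarrow> real" where
  "vec_norm v = L2_set (\<lambda>i. norm (v $ i)) {..<dim_vec v}"

instantiation vec :: (real_normed_vector) metric_space
begin

definition dist_vec :: "'a vec \<Rightarrow> 'a vec \<Rightarrow> real" where
  "dist_vec v w =
    (if dim_vec v = dim_vec w then vec_norm (v - w) else vec_norm v + vec_norm w + 1)"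

definition uniformity_vec :: "('a vec \<times> 'a vec) filter" where
  "uniformity_vec = (INF e\<in>{0<..}. principal {(v, w). dist v w < e})"

definition open_vec :: "'a vec set \<Rightarrow> bool" where
  "open_vec U \<longleftrightarrow> (\<forall>v\<in>U. eventually (\<lambda>(v', w). v' = v \<longrightarrow> w \<in> U) uniformity)"

lemma vec_norm_nonneg: "0 \<le> vec_norm (v :: 'a vec)"
  by (simp add: vec_norm_def)

lemma vec_norm_eq_0: "vec_norm (v :: 'a vec) = 0 \<longleftrightarrow> (\<forall>i<dim_vec v. v $ i = 0)"
  by (auto simp: vec_norm_def L2_set_eq_0_iff)

lemma vec_norm_minus_le:
  fixes u v w :: "'a vec"
  assumes "dim_vec u = dim_vec w" "dim_vec v = dim_vec w"
  shows "vec_norm (u - v) \<le> vec_norm (u - w) + vec_norm (v - w)"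
proof -
  have "vec_norm (u - v) \<le>
      L2_set (\<lambda>i. norm ((u - w) $ i) + norm ((v - w) $ i)) {..<dim_vec w}"
    unfolding vec_norm_def using assms
    by (auto intro!: L2_set_mono order_trans[OF _ norm_triangle_ineq4])
  also have "\<dots> \<le> vec_norm (u - w) + vec_norm (v - w)"
    unfolding vec_norm_def using L2_set_triangle_ineq assms by auto
  finally show ?thesis .
qed

lemma vec_norm_le_diff:
  fixes v w :: "'a vec"
  assumes "dim_vec v = dim_vec w"
  shows "vec_norm v \<le> vec_norm (v - w) + vec_norm w"
proof -
  have "vec_norm v \<le> L2_set (\<lambda>i. norm ((v - w) $ i) + norm (w $ i)) {..<dim_vec w}"
    unfolding vec_norm_def using assms
    by (auto intro!: L2_set_mono)
       (metis diff_add_cancel norm_triangle_ineq)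
  also have "\<dots> \<le> vec_norm (v - w) + vec_norm w"
    unfolding vec_norm_def using L2_set_triangle_ineq assms by auto
  finally show ?thesis .
qed

lemma vec_norm_minus_le_add:
  fixes v w :: "'a vec"
  assumes "dim_vec v = dim_vec w"
  shows "vec_norm (v - w) \<le> vec_norm v + vec_norm w"
proof -
  have "vec_norm (v - w) \<le> L2_set (\<lambda>i. norm (v $ i) + norm (w $ i)) {..<dim_vec w}"
    unfolding vec_norm_def using assms
    by (auto intro!: L2_set_mono norm_triangle_ineq4)
  also have "\<dots> \<le> vec_norm v + vec_norm w"
    unfolding vec_norm_def using L2_set_triangle_ineq assms by auto
  finally show ?thesis .
qed

instance
proof
  show "uniformity = (INF e\<in>{0<..}. principal {(v, w :: 'a vec). dist v w < e})"
    by (rule uniformity_vec_def)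
  show "open U \<longleftrightarrow> (\<forall>v\<in>U. \<forall>\<^sub>F (v', w) in uniformity. v' = v \<longrightarrow> w \<in> U)"
    for U :: "'a vec set"
    by (rule open_vec_def)
  show "dist v w = 0 \<longleftrightarrow> v = w" for v w :: "'a vec"
    using vec_norm_nonneg[of v] vec_norm_nonneg[of w]
    by (auto simp: dist_vec_def vec_norm_eq_0 intro: eq_vecI)
  show "dist u v \<le> dist u w + dist v w" for u v w :: "'a vec"
    using vec_norm_nonneg[of u] vec_norm_nonneg[of v] vec_norm_nonneg[of w]
      vec_norm_minus_le[of u w v] vec_norm_minus_le_add[of u v]
      vec_norm_le_diff[of u w] vec_norm_le_diff[of v w]
    by (auto simp: dist_vec_def)
qed

end

definition locally_lipschitz_on ::
    "'a::metric_space set \<Rightarrow> ('a \<Rightarrow> 'b::metric_space) \<Rightarrow> bool" where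
  "locally_lipschitz_on U f \<longleftrightarrow>
    (\<forall>x\<in>U. \<exists>e>0. \<exists>L. L-lipschitz_on (cball x e \<inter> U) f)"

definition partial :: "(real vec \<Rightarrow> real) \<Rightarrow> real vec \<Rightarrow> nat \<Rightarrow> real" where
  "partial g x j = deriv (\<lambda>t. g (x + t \<cdot>\<^sub>v unit_vec (dim_vec x) j)) 0"

definition gradient :: "(real vec \<Rightarrow> real) \<Rightarrow> real vec \<Rightarrow> real vec" where
  "gradient g x = vec (dim_vec x) (partial g x)"

definition continuously_differentiable ::
    "nat \<Rightarrow> nat \<Rightarrow> (real vec \<Rightarrow> real vec \<Rightarrow> real) \<Rightarrow> bool" where
  "continuously_differentiable n n' V \<longleftrightarrow>
    (\<forall>x\<in>carrier_vec n. \<forall>x'\<in>carrier_vec n'.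
      (\<forall>j<n. (\<lambda>t. V (x + t \<cdot>\<^sub>v unit_vec n j) x') differentiable at 0) \<and>
      (\<forall>j<n'. (\<lambda>t. V x (x' + t \<cdot>\<^sub>v unit_vec n' j)) differentiable at 0)) \<and>
    (\<forall>j<n. continuous_on (carrier_vec n \<times> carrier_vec n')
      (\<lambda>(x, x'). partial (\<lambda>y. V y x') x j)) \<and>
    (\<forall>j<n'. continuous_on (carrier_vec n \<times> carrier_vec n')
      (\<lambda>(x, x'). partial (\<lambda>y. V x y) x' j))"

section \<open>Comparison functions\<close>

text \<open>Only the values on \<open>{0..}\<close> matter.\<close>

definition class_K :: "(real \<Rightarrow> real) \<Rightarrow> bool" where
  "class_K \<alpha> \<longleftrightarrow> continuous_on {0..} \<alpha> \<and> strict_mono_on {0..} \<alpha> \<and> \<alpha> 0 = 0"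

definition class_K_inf :: "(real \<Rightarrow> real) \<Rightarrow> bool" where
  "class_K_inf \<alpha> \<longleftrightarrow> class_K \<alpha> \<and> filterlim \<alpha> at_top at_top"

definition class_K_zero :: "(real \<Rightarrow> real) \<Rightarrow> bool" where
  "class_K_zero \<alpha> \<longleftrightarrow> class_K \<alpha> \<or> (\<forall>s\<ge>0. \<alpha> s = 0)"

section \<open>Block matrices and the semidefinite order\<close>

definition quad_form :: "real mat \<Rightarrow> real vec \<Rightarrow> real" where
  "quad_form A x = x \<bullet> (A *\<^sub>v x)"

definition symmetric_mat :: "nat \<Rightarrow> real mat \<Rightarrow> bool" where
  "symmetric_mat n A \<longleftrightarrow> A \<in> carrier_mat n n \<and> transpose_mat A = A"

definition semidef_le :: "nat \<Rightarrow> real mat \<Rightarrow> real mat \<Rightarrow> bool" where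
  "semidef_le n A B \<longleftrightarrow> symmetric_mat n A \<and> symmetric_mat n B \<and>
    (\<forall>x\<in>carrier_vec n. 0 \<le> quad_form (B - A) x)"

definition block_diag :: "nat \<Rightarrow> (nat \<Rightarrow> real mat) \<Rightarrow> real mat" where
  "block_diag N A = diag_block_mat (map A [0..<N])"

definition block_X :: "nat \<Rightarrow> (nat \<Rightarrow> real) \<Rightarrow>
    (nat \<Rightarrow> real mat) \<Rightarrow> (nat \<Rightarrow> real mat) \<Rightarrow> (nat \<Rightarrow> real mat) \<Rightarrow> (nat \<Rightarrow> real mat) \<Rightarrow>
    real mat" where
  "block_X N \<mu> X11 X12 X21 X22 = four_block_mat
    (block_diag N (\<lambda>i. \<mu> i \<cdot>\<^sub>m X11 i)) (block_diag N (\<lambda>i. \<mu> i \<cdot>\<^sub>m X12 i))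
    (block_diag N (\<lambda>i. \<mu> i \<cdot>\<^sub>m X21 i)) (block_diag N (\<lambda>i. \<mu> i \<cdot>\<^sub>m X22 i))"

text \<open>
  \<open>vec_concat N v\<close> is \<open>[v 0; \<dots>; v (N - 1)]\<close>; conversely \<open>vec_block d i x\<close> is the \<open>i\<close>-th block of
  a vector \<open>x\<close> that is partitioned into blocks of dimensions \<open>d 0, d 1, \<dots>\<close>.
\<close>

definition vec_concat :: "nat \<Rightarrow> (nat \<Rightarrow> real vec) \<Rightarrow> real vec" where
  "vec_concat N v = foldr (@\<^sub>v) (map v [0..<N]) (0\<^sub>v 0)"

definition vec_block :: "(nat \<Rightarrow> nat) \<Rightarrow> nat \<Rightarrow> real vec \<Rightarrow> real vec" where
  "vec_block d i x = vec (d i) (\<lambda>j. x $ ((\<Sum>k<i. d k) + j))"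

section \<open>Control systems and practical simulation functions\<close>

record system =
  state_dim :: nat
  input_dim :: nat
  dynamics :: "real vec \<Rightarrow> real vec \<Rightarrow> real vec"
  output_dim :: nat
  out_map :: "real vec \<Rightarrow> real vec"

definition control_system :: "system \<Rightarrow> bool" where
  "control_system S \<longleftrightarrow>
    (\<forall>x\<in>carrier_vec (state_dim S). \<forall>u\<in>carrier_vec (input_dim S).
      dynamics S x u \<in> carrier_vec (state_dim S)) \<and>
    locally_lipschitz_on (carrier_vec (state_dim S) \<times> carrier_vec (input_dim S))
      (\<lambda>(x, u). dynamics S x u) \<and>
    (\<forall>x\<in>carrier_vec (state_dim S). out_map S x \<in> carrier_vec (output_dim S))"

text \<open>
  \<open>simulation_data S' S V v \<nu> \<eta> \<rho> \<Delta>\<close>: the function \<open>V\<close> is a practical simulation function from the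
  abstraction \<open>S'\<close> to \<open>S\<close>, witnessed by the interface \<open>v\<close> and the functions \<open>\<nu>, \<eta>, \<rho>, \<Delta>\<close>.
\<close>

definition simulation_data :: "system \<Rightarrow> system \<Rightarrow> (real vec \<Rightarrow> real vec \<Rightarrow> real) \<Rightarrow>
    (real vec \<Rightarrow> real vec \<Rightarrow> real vec \<Rightarrow> real vec) \<Rightarrow>
    (real \<Rightarrow> real) \<Rightarrow> (real \<Rightarrow> real) \<Rightarrow> (real \<Rightarrow> real) \<Rightarrow> (real vec \<Rightarrow> real) \<Rightarrow> bool" where
  "simulation_data S' S V v \<nu> \<eta> \<rho> \<Delta> \<longleftrightarrow>
    (let C = carrier_vec (state_dim S); C' = carrier_vec (state_dim S');
         U = carrier_vec (input_dim S); U' = carrier_vec (input_dim S')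
     in control_system S' \<and> control_system S \<and> output_dim S' = output_dim S \<and>
        continuously_differentiable (state_dim S) (state_dim S') V \<and>
        (\<forall>x\<in>C. \<forall>x'\<in>C'. 0 \<le> V x x') \<and>
        (\<forall>x\<in>C. \<forall>x'\<in>C'. \<forall>u'\<in>U'. v x x' u' \<in> U) \<and>
        locally_lipschitz_on (C \<times> C' \<times> U') (\<lambda>(x, x', u'). v x x' u') \<and>
        class_K_inf \<nu> \<and> class_K_inf \<eta> \<and> class_K_zero \<rho> \<and> (\<forall>x'\<in>C'. 0 \<le> \<Delta> x') \<and>
        (\<forall>x\<in>C. \<forall>x'\<in>C'. \<nu> (vec_norm (out_map S x - out_map S' x')) \<le> V x x') \<and>
        (\<forall>x\<in>C. \<forall>x'\<in>C'. \<forall>u'\<in>U'.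
          gradient (\<lambda>y. V y x') x \<bullet> dynamics S x (v x x' u')
            + gradient (\<lambda>y. V x y) x' \<bullet> dynamics S' x' u'
          \<le> - \<eta> (V x x') + \<rho> (vec_norm u') + \<Delta> x'))"

definition practical_simulation_function ::
    "system \<Rightarrow> system \<Rightarrow> (real vec \<Rightarrow> real vec \<Rightarrow> real) \<Rightarrow> bool" where
  "practical_simulation_function S' S V \<longleftrightarrow> (\<exists>v \<nu> \<eta> \<rho> \<Delta>. simulation_data S' S V v \<nu> \<eta> \<rho> \<Delta>)"

section \<open>Control subsystems and practical storage functions\<close>

record subsystem =
  sub_n :: nat
  sub_m :: nat
  sub_p :: nat
  sub_f :: "real vec \<Rightarrow> real vec \<Rightarrow> real vec \<Rightarrow> real vec"
  sub_q1 :: nat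
  sub_q2 :: nat
  sub_h1 :: "real vec \<Rightarrow> real vec"
  sub_h2 :: "real vec \<Rightarrow> real vec"

definition control_subsystem :: "subsystem \<Rightarrow> bool" where
  "control_subsystem S \<longleftrightarrow>
    (\<forall>x\<in>carrier_vec (sub_n S). \<forall>u\<in>carrier_vec (sub_m S). \<forall>w\<in>carrier_vec (sub_p S).
      sub_f S x u w \<in> carrier_vec (sub_n S)) \<and>
    locally_lipschitz_on
      (carrier_vec (sub_n S) \<times> carrier_vec (sub_m S) \<times> carrier_vec (sub_p S))
      (\<lambda>(x, u, w). sub_f S x u w) \<and>
    (\<forall>x\<in>carrier_vec (sub_n S). sub_h1 S x \<in> carrier_vec (sub_q1 S)) \<and>
    (\<forall>x\<in>carrier_vec (sub_n S). sub_h2 S x \<in> carrier_vec (sub_q2 S)) \<and>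
    locally_lipschitz_on (carrier_vec (sub_n S)) (sub_h2 S)"

text \<open>
  \<open>V\<close> is a practical storage function from the abstraction \<open>S'\<close> to \<open>S\<close> with the given interface,
  functions and matrices. The common number of rows of \<open>W\<close> and \<open>W'\<close>, which is also the size of
  \<open>X11\<close>, is unconstrained.
\<close>

definition practical_storage_function ::
    "subsystem \<Rightarrow> subsystem \<Rightarrow> (real vec \<Rightarrow> real vec \<Rightarrow> real) \<Rightarrow>
    (real vec \<Rightarrow> real vec \<Rightarrow> real vec \<Rightarrow> real vec) \<Rightarrow>
    (real \<Rightarrow> real) \<Rightarrow> (real \<Rightarrow> real) \<Rightarrow> (real \<Rightarrow> real) \<Rightarrow> (real vec \<Rightarrow> real) \<Rightarrow>
    real mat \<Rightarrow> real mat \<Rightarrow> real mat \<Rightarrow>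
    real mat \<Rightarrow> real mat \<Rightarrow> real mat \<Rightarrow> real mat \<Rightarrow> bool" where
  "practical_storage_function S' S V v \<nu> \<eta> \<rho> \<Delta> W W' H X11 X12 X21 X22 \<longleftrightarrow>
    (let C = carrier_vec (sub_n S); C' = carrier_vec (sub_n S');
         U = carrier_vec (sub_m S); U' = carrier_vec (sub_m S');
         r = dim_row W; q = sub_q2 S; X = four_block_mat X11 X12 X21 X22
     in control_subsystem S' \<and> control_subsystem S \<and> sub_q1 S' = sub_q1 S \<and>
        continuously_differentiable (sub_n S) (sub_n S') V \<and>
        (\<forall>x\<in>C. \<forall>x'\<in>C'. 0 \<le> V x x') \<and>
        (\<forall>x\<in>C. \<forall>x'\<in>C'. \<forall>u'\<in>U'. v x x' u' \<in> U) \<and>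
        locally_lipschitz_on (C \<times> C' \<times> U') (\<lambda>(x, x', u'). v x x' u') \<and>
        class_K_inf \<nu> \<and> class_K_inf \<eta> \<and> class_K_zero \<rho> \<and> (\<forall>x'\<in>C'. 0 \<le> \<Delta> x') \<and>
        W \<in> carrier_mat r (sub_p S) \<and> W' \<in> carrier_mat r (sub_p S') \<and>
        H \<in> carrier_mat q (sub_q2 S') \<and>
        X11 \<in> carrier_mat r r \<and> X12 \<in> carrier_mat r q \<and>
        X21 \<in> carrier_mat q r \<and> X22 \<in> carrier_mat q q \<and> symmetric_mat (r + q) X \<and>
        (\<forall>x\<in>C. \<forall>x'\<in>C'. \<nu> (vec_norm (sub_h1 S x - sub_h1 S' x')) \<le> V x x') \<and>
        (\<forall>x\<in>C. \<forall>x'\<in>C'. \<forall>u'\<in>U'. \<forall>w\<in>carrier_vec (sub_p S). \<forall>w'\<in>carrier_vec (sub_p S').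
          gradient (\<lambda>y. V y x') x \<bullet> sub_f S x (v x x' u') w
            + gradient (\<lambda>y. V x y) x' \<bullet> sub_f S' x' u' w'
          \<le> - \<eta> (V x x') + \<rho> (vec_norm u') + \<Delta> x'
            + quad_form X
                ((W *\<^sub>v w - W' *\<^sub>v w') @\<^sub>v (sub_h2 S x - H *\<^sub>v sub_h2 S' x'))))"

section \<open>Interconnection\<close>

definition stacked_h2 :: "nat \<Rightarrow> (nat \<Rightarrow> subsystem) \<Rightarrow> real vec \<Rightarrow> real vec" where
  "stacked_h2 N S x = vec_concat N (\<lambda>i. sub_h2 (S i) (vec_block (\<lambda>k. sub_n (S k)) i x))"

definition interconnection :: "nat \<Rightarrow> (nat \<Rightarrow> subsystem) \<Rightarrow> real mat \<Rightarrow> system" where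
  "interconnection N S M =
    (let n = (\<lambda>i. sub_n (S i)); m = (\<lambda>i. sub_m (S i)); p = (\<lambda>i. sub_p (S i))
     in \<lparr> state_dim = (\<Sum>i<N. n i),
          input_dim = (\<Sum>i<N. m i),
          dynamics = (\<lambda>x u. vec_concat N (\<lambda>i.
            sub_f (S i) (vec_block n i x) (vec_block m i u)
              (vec_block p i (M *\<^sub>v stacked_h2 N S x)))),
          output_dim = (\<Sum>i<N. sub_q1 (S i)),
          out_map = (\<lambda>x. vec_concat N (\<lambda>i. sub_h1 (S i) (vec_block n i x))) \<rparr>)"

end

theory Submission
  imports Defs
begin

text \<open>
  Why the weighted sum \<open>V = \<Sum>i. \<mu> i * V i\<close> is a practical simulation function. Its gradient is the
  concatenation of the gradients of the summands, so its derivative along the two interconnected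
  systems is the weighted sum of the subsystem derivatives
  (\<open>gradient_block_sum_scalar_prod\<close>). Each of these is bounded by the dissipation inequality
  of \<open>V i\<close>, in which the internal inputs occur only through the supply rate, a quadratic form in
  \<open>X i\<close>.

  The weighted supply rates add up to the quadratic form of \<open>block_X\<close> at the stacked vector
  \<open>[W w - W' w'; y - H y']\<close>, where \<open>y\<close>, \<open>y'\<close> are the stacked internal outputs. Substituting the
  couplings \<open>w = M y\<close> and \<open>w' = M' y'\<close> gives
  \<open>W w - W' w' = W M (y - H y') + (W M H - W' M') y' = W M (y - H y') + Y y'\<close>,
  so that the stacked vector is \<open>[Y, W M; 0, 1] [y'; y - H y']\<close>, and the linear matrix inequality
  with \<open>Z\<close> bounds the form by \<open>y'\<^sup>T Z y'\<close> (\<open>coupled_supply_bound\<close>). This is the new term of \<open>\<Delta>\<close>;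
  the other one collects the functions \<open>\<Delta> i\<close>.

  The comparison functions have to be merged as well. For any \<open>\<alpha> i\<close> of class \<open>\<K>\<^sub>\<infinity>\<close> there is one
  \<open>\<beta>\<close> of this class with \<open>\<beta> (\<Sum>i. t i) \<le> \<Sum>i. \<alpha> i (t i)\<close> for all nonnegative \<open>t i\<close>
  (\<open>class_K_inf_sum_lower_bound\<close>). It yields \<open>\<nu>\<close> from \<open>\<alpha> i = \<mu> i * \<nu> i\<close> with \<open>t i\<close> the norm of the
  \<open>i\<close>-th output error, and \<open>\<eta>\<close> from \<open>\<alpha> i = \<mu> i * \<eta> i (\<cdot> / \<mu> i)\<close> with \<open>t i = \<mu> i * V i\<close>. For \<open>\<rho>\<close>
  the sum \<open>\<Sum>i. \<mu> i * \<rho> i\<close> suffices, since a block of \<open>u'\<close> is no longer than \<open>u'\<close>.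

  The rest is regularity: forming blocks, concatenating and multiplying by a matrix are Lipschitz
  maps, so the interconnected dynamics and the concatenated interface are locally Lipschitz
  (\<open>control_system_interconnection\<close>, \<open>locally_lipschitz_on_interfaces\<close>), and a partial derivative of
  the sum is a partial derivative of a single summand composed with block projections
  (\<open>continuously_differentiable_block_sum\<close>).
\<close>

section \<open>Block decomposition of vectors\<close>

text \<open>
  The index \<open>(\<Sum>k<i. d k) + l\<close> is entry \<open>l\<close> of block \<open>i\<close>. The three lemmas say that
  \<open>(i, l) \<mapsto> (\<Sum>k<i. d k) + l\<close> is a bijection from the pairs with \<open>i < N\<close> and \<open>l < d i\<close> to the indices
  below \<open>\<Sum>k<N. d k\<close>, which reduces statements about entries of a concatenation to blocks.
\<close>

lemma block_index_less:
  fixes d :: "nat \<Rightarrow> nat"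
  assumes "i < N" "l < d i"
  shows "(\<Sum>k<i. d k) + l < (\<Sum>k<N. d k)"
proof -
  have "(\<Sum>k<i. d k) + l < (\<Sum>k<Suc i. d k)"
    using assms by simp
  also have "\<dots> \<le> (\<Sum>k<N. d k)"
    using assms by (intro sum_mono2) auto
  finally show ?thesis .
qed

lemma block_index_exists:
  fixes d :: "nat \<Rightarrow> nat"
  assumes "j < (\<Sum>k<N. d k)"
  shows "\<exists>i<N. \<exists>l<d i. j = (\<Sum>k<i. d k) + l"
  using assms
proof (induction N)
  case (Suc N)
  show ?case
  proof (cases "j < (\<Sum>k<N. d k)")
    case True
    then show ?thesis
      using Suc.IH less_SucI by blast
  next
    case False
    then have "j - (\<Sum>k<N. d k) < d N" "j = (\<Sum>k<N. d k) + (j - (\<Sum>k<N. d k))"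
      using Suc.prems by auto
    then show ?thesis
      using lessI by blast
  qed
qed simp

lemma block_index_inject:
  fixes d :: "nat \<Rightarrow> nat"
  assumes "l < d i" "l' < d i'" "(\<Sum>k<i. d k) + l = (\<Sum>k<i'. d k) + l'"
  shows "i = i' \<and> l = l'"
proof -
  have "\<not> i < i'" "\<not> i' < i"
    using block_index_less[of i i' l d] block_index_less[of i' i l' d] assms by auto
  then show ?thesis
    using assms by auto
qed

lemma vec_concat_0 [simp]: "vec_concat 0 a = 0\<^sub>v 0"
  by (simp add: vec_concat_def)

lemma vec_concat_Suc: "vec_concat (Suc N) a = vec_concat N a @\<^sub>v a N"
proof -
  have "foldr (@\<^sub>v) vs b = foldr (@\<^sub>v) vs (0\<^sub>v 0) @\<^sub>v b" for vs :: "real vec list" and b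
    by (induction vs) (auto intro!: eq_vecI)
  from this[of _ "a N @\<^sub>v 0\<^sub>v 0"] show ?thesis
    by (auto simp: vec_concat_def intro!: eq_vecI)
qed

lemma dim_vec_concat [simp]: "dim_vec (vec_concat N a) = (\<Sum>i<N. dim_vec (a i))"
  by (induction N) (auto simp: vec_concat_Suc)

lemma vec_concat_carrier [intro]:
  assumes "\<And>i. i < N \<Longrightarrow> a i \<in> carrier_vec (d i)"
  shows "vec_concat N a \<in> carrier_vec (\<Sum>i<N. d i)"
  using assms by (auto intro!: carrier_vecI sum.cong)

lemma vec_concat_cong:
  assumes "\<And>i. i < N \<Longrightarrow> a i = b i"
  shows "vec_concat N a = vec_concat N b"
  using assms by (induction N) (auto simp: vec_concat_Suc)

lemma vec_block_carrier [simp]: "d i = k \<Longrightarrow> vec_block d i x \<in> carrier_vec k"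
  by (auto simp: vec_block_def)

lemma dim_vec_block [simp]: "dim_vec (vec_block d i x) = d i"
  by (simp add: vec_block_def)

lemma index_vec_concat:
  assumes "\<And>k. k < N \<Longrightarrow> dim_vec (a k) = d k" "i < N" "l < d i"
  shows "vec_concat N a $ ((\<Sum>k<i. d k) + l) = a i $ l"
  using assms
proof (induction N)
  case (Suc N)
  have dim: "dim_vec (vec_concat N a) = (\<Sum>k<N. d k)"
    using Suc.prems by auto
  show ?case
  proof (cases "i = N")
    case True
    then show ?thesis
      using Suc.prems dim by (simp add: vec_concat_Suc del: dim_vec_concat)
  next
    case False
    then have "i < N"
      using Suc.prems by simp
    moreover from this have "(\<Sum>k<i. d k) + l < (\<Sum>k<N. d k)"
      using Suc.prems by (intro block_index_less)
    ultimately show ?thesis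
      using Suc dim by (simp add: vec_concat_Suc del: dim_vec_concat)
  qed
qed simp

lemma vec_block_vec_concat:
  assumes "\<And>k. k < N \<Longrightarrow> a k \<in> carrier_vec (d k)" "i < N"
  shows "vec_block d i (vec_concat N a) = a i"
proof -
  have dim: "dim_vec (a k) = d k" if "k < N" for k
    using assms(1)[OF that] by auto
  then show ?thesis
    using assms(2) by (auto simp: vec_block_def index_vec_concat intro!: eq_vecI)
qed

lemma vec_concat_vec_block:
  assumes "x \<in> carrier_vec (\<Sum>k<N. d k)"
  shows "vec_concat N (\<lambda>i. vec_block d i x) = x"
proof (rule eq_vecI)
  fix j assume "j < dim_vec x"
  then have "j < (\<Sum>k<N. d k)"
    using assms by simp
  then obtain i l where "i < N" "l < d i" "j = (\<Sum>k<i. d k) + l"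
    using block_index_exists by blast
  then show "vec_concat N (\<lambda>i. vec_block d i x) $ j = x $ j"
    by (simp add: index_vec_concat[where d = d]) (simp add: vec_block_def)
qed (use assms in simp)

lemma append_vec_diff:
  fixes a b c d :: "real vec"
  assumes "dim_vec a = dim_vec c" "dim_vec b = dim_vec d"
  shows "(a @\<^sub>v b) - (c @\<^sub>v d) = (a - c) @\<^sub>v (b - d)"
  using assms by (auto intro!: eq_vecI)

lemma vec_concat_diff:
  assumes "\<And>i. i < N \<Longrightarrow> dim_vec (a i) = dim_vec (b i)"
  shows "vec_concat N a - vec_concat N b = vec_concat N (\<lambda>i. a i - b i)"
  using assms by (induction N) (auto simp: vec_concat_Suc append_vec_diff)

lemma scalar_prod_append':
  fixes a b c d :: "real vec"
  assumes "dim_vec a = dim_vec c" "dim_vec b = dim_vec d"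
  shows "(a @\<^sub>v b) \<bullet> (c @\<^sub>v d) = a \<bullet> c + b \<bullet> d"
  using assms
  by (intro scalar_prod_append[of _ "dim_vec c" _ "dim_vec d"]) (auto intro: carrier_vecI)

lemma scalar_prod_vec_concat:
  assumes "\<And>i. i < N \<Longrightarrow> dim_vec (a i) = dim_vec (b i)"
  shows "vec_concat N a \<bullet> vec_concat N b = (\<Sum>i<N. a i \<bullet> b i)"
  using assms by (induction N) (auto simp: vec_concat_Suc scalar_prod_append')

lemma vec_norm_power2: "(vec_norm (x :: real vec))\<^sup>2 = x \<bullet> x"
  by (simp add: vec_norm_def L2_set_def sum_nonneg scalar_prod_def lessThan_atLeast0
      power2_eq_square)

lemma vec_norm_append:
  "vec_norm (a @\<^sub>v b :: real vec) = sqrt ((vec_norm a)\<^sup>2 + (vec_norm b)\<^sup>2)"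
  using vec_norm_power2[of "a @\<^sub>v b"] vec_norm_nonneg[of "a @\<^sub>v b"]
  by (metis scalar_prod_append' vec_norm_power2 real_sqrt_unique)

text \<open>
  Nested Euclidean norms collapse; both the estimate of a concatenation by the sum of its parts and
  that of a block by the whole vector are read off from this identity.
\<close>

lemma vec_norm_vec_concat: "vec_norm (vec_concat N a) = L2_set (\<lambda>i. vec_norm (a i)) {..<N}"
proof -
  have "(vec_norm (vec_concat N a))\<^sup>2 = (\<Sum>i<N. (vec_norm (a i))\<^sup>2)"
    by (simp add: vec_norm_power2 scalar_prod_vec_concat)
  then show ?thesis
    unfolding L2_set_def using vec_norm_nonneg[of "vec_concat N a"] by (simp add: real_sqrt_unique)
qed

lemma vec_norm_vec_concat_le: "vec_norm (vec_concat N a) \<le> (\<Sum>i<N. vec_norm (a i))"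
  unfolding vec_norm_vec_concat by (intro L2_set_le_sum) (auto simp: vec_norm_nonneg)

lemma vec_norm_vec_block_le:
  assumes "x \<in> carrier_vec (\<Sum>k<N. d k)" "i < N"
  shows "vec_norm (vec_block d i x) \<le> vec_norm x"
proof -
  have "vec_norm x = L2_set (\<lambda>i. vec_norm (vec_block d i x)) {..<N}"
    using vec_norm_vec_concat[of N "\<lambda>i. vec_block d i x"] assms
    by (simp add: vec_concat_vec_block)
  then show ?thesis
    using member_le_L2_set[of "{..<N}" i "\<lambda>i. vec_norm (vec_block d i x)"] assms by simp
qed

text \<open>
  Cauchy-Schwarz in each row. The constant is far from optimal, but any finite one makes matrix
  multiplication Lipschitz.
\<close>

lemma vec_norm_mult_mat_vec_le:
  fixes A :: "real mat"
  assumes "dim_vec x = dim_col A"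
  shows "vec_norm (A *\<^sub>v x) \<le> (\<Sum>i<dim_row A. vec_norm (row A i)) * vec_norm x"
proof -
  have *: "abs (row A i \<bullet> x) \<le> vec_norm (row A i) * vec_norm x" if "i < dim_row A" for i
  proof -
    have "abs (row A i \<bullet> x) \<le> (\<Sum>j<dim_vec x. \<bar>row A i $ j\<bar> * \<bar>x $ j\<bar>)"
      unfolding scalar_prod_def abs_mult[symmetric] lessThan_atLeast0 by (rule sum_abs)
    also have "\<dots> \<le> L2_set (\<lambda>j. row A i $ j) {..<dim_vec x} * L2_set (\<lambda>j. x $ j) {..<dim_vec x}"
      by (rule L2_set_mult_ineq)
    also have "\<dots> = vec_norm (row A i) * vec_norm x"
      using assms by (simp add: vec_norm_def L2_set_def)
    finally show ?thesis .
  qed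
  have "vec_norm (A *\<^sub>v x) \<le> (\<Sum>i<dim_row A. abs (row A i \<bullet> x))"
    unfolding vec_norm_def by (rule order_trans[OF L2_set_le_sum]) auto
  also have "\<dots> \<le> (\<Sum>i<dim_row A. vec_norm (row A i) * vec_norm x)"
    using * by (intro sum_mono) auto
  finally show ?thesis
    by (simp add: sum_distrib_right)
qed

section \<open>Lipschitz continuity\<close>

lemma lipschitz_on_vec_block:
  assumes "i < N"
  shows "1-lipschitz_on (carrier_vec (\<Sum>k<N. d k)) (vec_block d i)"
proof (rule lipschitz_onI)
  fix x y :: "real vec"
  assume xy: "x \<in> carrier_vec (\<Sum>k<N. d k)" "y \<in> carrier_vec (\<Sum>k<N. d k)"
  have "vec_block d i x - vec_block d i y = vec_block d i (x - y)"
    using xy block_index_less[OF assms] by (auto simp: vec_block_def intro!: eq_vecI)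
  then show "dist (vec_block d i x) (vec_block d i y) \<le> 1 * dist x y"
    using xy vec_norm_vec_block_le[of "x - y" d N i] assms by (simp add: dist_vec_def)
qed simp

lemma lipschitz_on_append_vec:
  "1-lipschitz_on (carrier_vec n \<times> carrier_vec m) (\<lambda>(a, b). a @\<^sub>v b :: real vec)"
  by (rule lipschitz_onI)
    (auto simp: dist_vec_def append_vec_diff vec_norm_append dist_prod_def)

lemma lipschitz_on_mult_mat_vec:
  fixes A :: "real mat"
  assumes "A \<in> carrier_mat nr nc"
  shows "(\<Sum>i<nr. vec_norm (row A i))-lipschitz_on (carrier_vec nc) ((*\<^sub>v) A)"
proof (rule lipschitz_onI)
  fix x y :: "real vec"
  assume xy: "x \<in> carrier_vec nc" "y \<in> carrier_vec nc"
  then have "A *\<^sub>v x - A *\<^sub>v y = A *\<^sub>v (x - y)"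
    using assms by (simp add: mult_minus_distrib_mat_vec)
  then show "dist (A *\<^sub>v x) (A *\<^sub>v y) \<le> (\<Sum>i<nr. vec_norm (row A i)) * dist x y"
    using xy assms vec_norm_mult_mat_vec_le[of "x - y" A] by (simp add: dist_vec_def)
qed (simp add: sum_nonneg vec_norm_nonneg)

lemma locally_lipschitz_on_lipschitz_on:
  "L-lipschitz_on U f \<Longrightarrow> locally_lipschitz_on U f"
  unfolding locally_lipschitz_on_def
  by (intro ballI exI[of _ 1] exI[of _ L] conjI) (auto intro: lipschitz_on_subset)

text \<open>
  The radius has to be small enough that \<open>f\<close>, with Lipschitz constant \<open>L1\<close>, maps the ball into the
  ball on which \<open>g\<close> is Lipschitz; dividing by \<open>L1 + 1\<close> instead of \<open>L1\<close> covers \<open>L1 = 0\<close>.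
\<close>

lemma locally_lipschitz_on_compose:
  assumes f: "locally_lipschitz_on U f" and g: "locally_lipschitz_on T g" and "f ` U \<subseteq> T"
  shows "locally_lipschitz_on U (\<lambda>x. g (f x))"
  unfolding locally_lipschitz_on_def
proof
  fix x assume x: "x \<in> U"
  obtain e1 L1 where 1: "e1 > 0" "L1-lipschitz_on (cball x e1 \<inter> U) f"
    using f x unfolding locally_lipschitz_on_def by blast
  obtain e2 L2 where 2: "e2 > 0" "L2-lipschitz_on (cball (f x) e2 \<inter> T) g"
    using g x assms(3) unfolding locally_lipschitz_on_def by blast
  have L1: "0 \<le> L1"
    using 1 lipschitz_on_nonneg by blast
  define e where "e = min e1 (e2 / (L1 + 1))"
  have e: "0 < e" "e \<le> e1" "(L1 + 1) * e \<le> e2"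
    using 1 2 L1 mult_left_mono[of e "e2 / (L1 + 1)" "L1 + 1"]
    by (auto simp: e_def)
  have "f ` (cball x e \<inter> U) \<subseteq> cball (f x) e2 \<inter> T"
  proof safe
    fix y assume y: "y \<in> cball x e" "y \<in> U"
    then have "dist (f x) (f y) \<le> L1 * dist x y"
      using 1 e x by (intro lipschitz_onD[OF 1(2)]) auto
    also have "\<dots> \<le> (L1 + 1) * e"
      using y L1 by (intro mult_mono) auto
    finally show "f y \<in> cball (f x) e2"
      using e by simp
    show "f y \<in> T"
      using y assms(3) by auto
  qed
  moreover have "L1-lipschitz_on (cball x e \<inter> U) f"
    using e by (intro lipschitz_on_subset[OF 1(2)]) auto
  ultimately have "(L2 * L1)-lipschitz_on (cball x e \<inter> U) (\<lambda>x. g (f x))"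
    using lipschitz_on_compose2 lipschitz_on_subset[OF 2(2)] by blast
  then show "\<exists>e>0. \<exists>L. L-lipschitz_on (cball x e \<inter> U) (\<lambda>x. g (f x))"
    using e by blast
qed

lemma locally_lipschitz_on_Pair:
  assumes f: "locally_lipschitz_on U f" and g: "locally_lipschitz_on U g"
  shows "locally_lipschitz_on U (\<lambda>x. (f x, g x))"
  unfolding locally_lipschitz_on_def
proof
  fix x assume x: "x \<in> U"
  obtain e1 L1 where 1: "e1 > 0" "L1-lipschitz_on (cball x e1 \<inter> U) f"
    using f x unfolding locally_lipschitz_on_def by blast
  obtain e2 L2 where 2: "e2 > 0" "L2-lipschitz_on (cball x e2 \<inter> U) g"
    using g x unfolding locally_lipschitz_on_def by blast
  define e where "e = min e1 e2"
  have "L1-lipschitz_on (cball x e \<inter> U) f" "L2-lipschitz_on (cball x e \<inter> U) g"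
    by (auto simp: e_def intro!: lipschitz_on_subset[OF 1(2)] lipschitz_on_subset[OF 2(2)])
  from lipschitz_on_Pair[OF this] show "\<exists>e>0. \<exists>L. L-lipschitz_on (cball x e \<inter> U) (\<lambda>x. (f x, g x))"
    using 1 2 by (intro exI[of _ e]) (auto simp: e_def)
qed

lemma locally_lipschitz_on_fst [intro]: "locally_lipschitz_on U fst"
  by (rule locally_lipschitz_on_lipschitz_on[of 1]) (rule lipschitz_onI, simp_all add: dist_fst_le)

lemma locally_lipschitz_on_snd [intro]: "locally_lipschitz_on U snd"
  by (rule locally_lipschitz_on_lipschitz_on[of 1]) (rule lipschitz_onI, simp_all add: dist_snd_le)

lemma locally_lipschitz_on_vec_concat:
  assumes "\<And>i. i < N \<Longrightarrow> locally_lipschitz_on U (f i)"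
    and "\<And>i x. i < N \<Longrightarrow> x \<in> U \<Longrightarrow> f i x \<in> carrier_vec (d i)"
  shows "locally_lipschitz_on U (\<lambda>x. vec_concat N (\<lambda>i. f i x))"
  using assms
proof (induction N)
  case 0
  show ?case
    by (simp add: locally_lipschitz_on_lipschitz_on[OF lipschitz_on_constant])
next
  case (Suc N)
  have "locally_lipschitz_on U (\<lambda>x. (vec_concat N (\<lambda>i. f i x), f N x))"
    using Suc by (intro locally_lipschitz_on_Pair) auto
  moreover have "(\<lambda>x. (vec_concat N (\<lambda>i. f i x), f N x)) ` U
      \<subseteq> carrier_vec (\<Sum>i<N. d i) \<times> carrier_vec (d N)"
    using Suc.prems by auto
  ultimately show ?case
    using locally_lipschitz_on_compose[OF _
        locally_lipschitz_on_lipschitz_on[OF lipschitz_on_append_vec]]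
    by (fastforce simp: vec_concat_Suc)
qed

lemma locally_lipschitz_on_vec_block:
  assumes "locally_lipschitz_on U f" "f ` U \<subseteq> carrier_vec (\<Sum>k<N. d k)" "i < N"
  shows "locally_lipschitz_on U (\<lambda>x. vec_block d i (f x))"
  by (rule locally_lipschitz_on_compose[OF assms(1) _ assms(2)])
    (rule locally_lipschitz_on_lipschitz_on[OF lipschitz_on_vec_block[OF assms(3)]])

section \<open>Comparison functions\<close>

lemma class_K_nonneg: "class_K \<alpha> \<Longrightarrow> 0 \<le> s \<Longrightarrow> 0 \<le> \<alpha> s"
  unfolding class_K_def using strict_mono_on_leD[of "{0..}" \<alpha> 0 s] by auto

lemma class_K_mono: "class_K \<alpha> \<Longrightarrow> 0 \<le> s \<Longrightarrow> s \<le> t \<Longrightarrow> \<alpha> s \<le> \<alpha> t"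
  unfolding class_K_def using strict_mono_on_leD[of "{0..}" \<alpha> s t] by auto

lemma class_K_scale:
  assumes "class_K \<alpha>" "0 < a" "0 < b"
  shows "class_K (\<lambda>s. a * \<alpha> (b * s))"
proof -
  have "continuous_on {0..} (\<lambda>s. \<alpha> (b * s))"
  proof (rule continuous_on_compose2[where t = "{0..}" and g = \<alpha>])
    show "continuous_on {0..} \<alpha>"
      using assms by (simp add: class_K_def)
    show "continuous_on {0..} (\<lambda>s. b * s)"
      by (intro continuous_intros)
    show "(\<lambda>s. b * s) ` {0..} \<subseteq> {0..}"
      using assms by auto
  qed
  moreover have "strict_mono_on {0..} (\<lambda>s. a * \<alpha> (b * s))"
  proof (rule strict_mono_onI)
    fix s t :: real assume "s \<in> {0..}" "t \<in> {0..}" "s < t"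
    then have "\<alpha> (b * s) < \<alpha> (b * t)"
      using assms by (intro strict_mono_onD[of "{0..}" \<alpha>]) (auto simp: class_K_def)
    then show "a * \<alpha> (b * s) < a * \<alpha> (b * t)"
      using assms by simp
  qed
  ultimately show ?thesis
    using assms by (auto simp: class_K_def intro!: continuous_intros)
qed

lemma class_K_inf_scale:
  assumes "class_K_inf \<alpha>" "0 < a" "0 < b"
  shows "class_K_inf (\<lambda>s. a * \<alpha> (b * s))"
proof -
  have "filterlim (\<lambda>s. b * s) at_top at_top"
    using assms by (intro filterlim_tendsto_pos_mult_at_top[OF tendsto_const])
      (auto simp: filterlim_ident)
  then have "filterlim (\<lambda>s. \<alpha> (b * s)) at_top at_top"
    using assms unfolding class_K_inf_def by (blast intro: filterlim_compose)
  then have "filterlim (\<lambda>s. a * \<alpha> (b * s)) at_top at_top"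
    using assms by (intro filterlim_tendsto_pos_mult_at_top[OF tendsto_const])
  then show ?thesis
    using assms by (auto simp: class_K_inf_def class_K_scale)
qed

lemma class_K_inf_min:
  assumes "class_K_inf \<alpha>" "class_K_inf \<beta>"
  shows "class_K_inf (\<lambda>s. min (\<alpha> s) (\<beta> s))"
proof -
  have "filterlim (\<lambda>s. min (\<alpha> s) (\<beta> s)) at_top at_top"
    using assms unfolding class_K_inf_def filterlim_at_top
    by (auto intro: eventually_conj)
  moreover have "strict_mono_on {0..} (\<lambda>s. min (\<alpha> s) (\<beta> s))"
    using assms unfolding class_K_inf_def class_K_def strict_mono_on_def
    by (auto simp: min_less_iff_disj)
  ultimately show ?thesis
    using assms by (auto simp: class_K_inf_def class_K_def intro!: continuous_intros)
qed

text \<open>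
  The pointwise minimum of finitely many functions is again of class \<open>\<K>\<^sub>\<infinity>\<close>. There has to be at
  least one function, hence the bound \<open>Suc N\<close>.
\<close>

lemma class_K_inf_common_lower_bound:
  assumes "\<And>i. i < Suc N \<Longrightarrow> class_K_inf (\<alpha> i)"
  shows "\<exists>\<beta>. class_K_inf \<beta> \<and> (\<forall>i<Suc N. \<forall>s. \<beta> s \<le> \<alpha> i s)"
  using assms
proof (induction N)
  case 0
  then show ?case
    by auto
next
  case (Suc N)
  then obtain \<beta> where \<beta>: "class_K_inf \<beta>" "\<forall>i<Suc N. \<forall>s. \<beta> s \<le> \<alpha> i s"
    by force
  show ?case
  proof (intro exI conjI)
    show "class_K_inf (\<lambda>s. min (\<beta> s) (\<alpha> (Suc N) s))"
      using \<beta> Suc.prems by (intro class_K_inf_min) auto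
    show "\<forall>i<Suc (Suc N). \<forall>s. min (\<beta> s) (\<alpha> (Suc N) s) \<le> \<alpha> i s"
      using \<beta> by (auto simp: less_Suc_eq min_le_iff_disj)
  qed
qed

text \<open>
  Some \<open>t i\<close> is at least the average, so a single summand on the right already dominates the minimum
  of the functions \<open>\<lambda>s. \<alpha> i (s / N)\<close> at the sum of all \<open>t i\<close>.
\<close>

lemma class_K_inf_sum_lower_bound:
  fixes \<alpha> :: "nat \<Rightarrow> real \<Rightarrow> real"
  assumes "\<And>i. i < N \<Longrightarrow> class_K_inf (\<alpha> i)" "0 < N"
  shows "\<exists>\<beta>. class_K_inf \<beta> \<and>
    (\<forall>t. (\<forall>i<N. 0 \<le> t i) \<longrightarrow> \<beta> (\<Sum>i<N. t i) \<le> (\<Sum>i<N. \<alpha> i (t i)))"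
proof -
  obtain m where m: "N = Suc m"
    using assms(2) gr0_conv_Suc by auto
  have K: "class_K (\<alpha> i)" if "i < N" for i
    using assms(1)[OF that] by (simp add: class_K_inf_def)
  have "class_K_inf (\<lambda>s. 1 * \<alpha> i (1 / N * s))" if "i < Suc m" for i
    using that assms m by (intro class_K_inf_scale) auto
  then obtain \<beta> where \<beta>: "class_K_inf \<beta>" "\<And>i s. i < N \<Longrightarrow> \<beta> s \<le> \<alpha> i (s / N)"
    using class_K_inf_common_lower_bound[of m "\<lambda>i s. 1 * \<alpha> i (1 / N * s)"] m by auto
  have "\<beta> (\<Sum>i<N. t i) \<le> (\<Sum>i<N. \<alpha> i (t i))" if t: "\<forall>i<N. 0 \<le> t i" for t
  proof -
    have "\<exists>i<N. (\<Sum>i<N. t i) / N \<le> t i"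
    proof (rule ccontr)
      assume "\<not> ?thesis"
      then have "(\<Sum>i<N. t i) < (\<Sum>i<N. (\<Sum>i<N. t i) / N)"
        using assms(2) by (intro sum_strict_mono) auto
      then show False
        using assms(2) by simp
    qed
    then obtain i where i: "i < N" "(\<Sum>i<N. t i) / N \<le> t i"
      by blast
    have "\<beta> (\<Sum>i<N. t i) \<le> \<alpha> i ((\<Sum>i<N. t i) / N)"
      using \<beta> i by blast
    also have "\<dots> \<le> \<alpha> i (t i)"
      using i t by (intro class_K_mono[OF K[OF i(1)]] divide_nonneg_nonneg sum_nonneg) auto
    also have "\<dots> \<le> (\<Sum>i<N. \<alpha> i (t i))"
      using i t class_K_nonneg[OF K] by (intro member_le_sum) auto
    finally show ?thesis .
  qed
  then show ?thesis
    using \<beta> by blast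
qed

lemma class_K_cong:
  assumes "\<And>s. 0 \<le> s \<Longrightarrow> \<alpha> s = \<beta> s"
  shows "class_K \<alpha> = class_K \<beta>"
proof -
  have "continuous_on {0..} \<alpha> = continuous_on {0..} \<beta>"
    using assms by (intro continuous_on_cong) auto
  then show ?thesis
    using assms by (auto simp: class_K_def strict_mono_on_def)
qed

text \<open>
  A summand that is zero need only be so on the nonnegative half-line, where \<open>class_K_cong\<close>
  removes it.
\<close>

lemma class_K_zero_add:
  assumes "class_K_zero \<alpha>" "class_K_zero \<beta>"
  shows "class_K_zero (\<lambda>s. \<alpha> s + \<beta> s)"
proof -
  have "class_K (\<lambda>s. \<alpha> s + \<beta> s)" if "class_K \<alpha>" "class_K \<beta>"
    using that by (auto simp: class_K_def strict_mono_on_def add_strict_mono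
        intro!: continuous_intros)
  moreover have "class_K (\<lambda>s. \<alpha> s + \<beta> s)" if "class_K \<alpha>" "\<forall>s\<ge>0. \<beta> s = 0"
    using that class_K_cong[of "\<lambda>s. \<alpha> s + \<beta> s" \<alpha>] by auto
  moreover have "class_K (\<lambda>s. \<alpha> s + \<beta> s)" if "class_K \<beta>" "\<forall>s\<ge>0. \<alpha> s = 0"
    using that class_K_cong[of "\<lambda>s. \<alpha> s + \<beta> s" \<beta>] by auto
  ultimately show ?thesis
    using assms by (auto simp: class_K_zero_def)
qed

lemma class_K_zero_sum:
  fixes \<mu> :: "nat \<Rightarrow> real"
  assumes "\<And>i. i < N \<Longrightarrow> class_K_zero (\<rho> i)" "\<And>i. i < N \<Longrightarrow> 0 < \<mu> i"
  shows "class_K_zero (\<lambda>s. \<Sum>i<N. \<mu> i * \<rho> i s)"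
  using assms
proof (induction N)
  case 0
  then show ?case
    by (simp add: class_K_zero_def)
next
  case (Suc N)
  have "class_K_zero (\<lambda>s. \<mu> N * \<rho> N s)"
    using Suc.prems(1)[of N] Suc.prems(2)[of N] class_K_scale[of "\<rho> N" "\<mu> N" 1]
    by (auto simp: class_K_zero_def)
  then show ?case
    using Suc by (simp add: class_K_zero_add)
qed

lemma class_K_zero_mono: "class_K_zero \<alpha> \<Longrightarrow> 0 \<le> s \<Longrightarrow> s \<le> t \<Longrightarrow> \<alpha> s \<le> \<alpha> t"
  unfolding class_K_zero_def using class_K_mono[of \<alpha> s t] by auto

section \<open>Derivatives of sums over blocks\<close>

text \<open>A step along a coordinate axis moves a single block, and moves it along an axis.\<close>

lemma vec_block_add_unit_vec:
  assumes "x \<in> carrier_vec (\<Sum>k<N. d k)" "i < N" "l < d i" "i' < N"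
  shows "vec_block d i' (x + t \<cdot>\<^sub>v unit_vec (\<Sum>k<N. d k) ((\<Sum>k<i. d k) + l))
    = (if i' = i then vec_block d i x + t \<cdot>\<^sub>v unit_vec (d i) l else vec_block d i' x)"
proof (rule eq_vecI)
  fix j assume "j < dim_vec (if i' = i then vec_block d i x + t \<cdot>\<^sub>v unit_vec (d i) l
    else vec_block d i' x)"
  then have j: "j < d i'"
    by (auto split: if_splits)
  have "(\<Sum>k<i'. d k) + j < (\<Sum>k<N. d k)"
    using assms j by (intro block_index_less)
  moreover have "(\<Sum>k<i'. d k) + j = (\<Sum>k<i. d k) + l \<longleftrightarrow> i' = i \<and> j = l"
    using assms j block_index_inject by blast
  ultimately show "vec_block d i' (x + t \<cdot>\<^sub>v unit_vec (\<Sum>k<N. d k) ((\<Sum>k<i. d k) + l)) $ j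
    = (if i' = i then vec_block d i x + t \<cdot>\<^sub>v unit_vec (d i) l else vec_block d i' x) $ j"
    using assms j by (auto simp: vec_block_def unit_vec_def)
qed simp

text \<open>
  Along a coordinate of block \<open>i\<close> all summands but the \<open>i\<close>-th are constant. Only differentiability
  of that one in the direction concerned is therefore assumed.
\<close>

lemma partial_block_sum:
  assumes "x \<in> carrier_vec (\<Sum>k<N. d k)" "i < N" "l < d i"
    and "(\<lambda>t. c i (vec_block d i x + t \<cdot>\<^sub>v unit_vec (d i) l)) differentiable at 0"
  shows "(\<lambda>t. \<Sum>k<N. c k (vec_block d k (x + t \<cdot>\<^sub>v unit_vec (\<Sum>k<N. d k) ((\<Sum>k<i. d k) + l))))
      differentiable at 0"
    and "partial (\<lambda>y. \<Sum>k<N. c k (vec_block d k y)) x ((\<Sum>k<i. d k) + l)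
      = partial (c i) (vec_block d i x) l"
proof -
  define D where "D = deriv (\<lambda>t. c i (vec_block d i x + t \<cdot>\<^sub>v unit_vec (d i) l)) 0"
  define F where "F = (\<lambda>t.
    \<Sum>k<N. c k (vec_block d k (x + t \<cdot>\<^sub>v unit_vec (\<Sum>k<N. d k) ((\<Sum>k<i. d k) + l))))"
  have "F = (\<lambda>t. c i (vec_block d i x + t \<cdot>\<^sub>v unit_vec (d i) l)
      + (\<Sum>k\<in>{..<N} - {i}. c k (vec_block d k x)))"
  proof
    fix t
    have "F t = (\<Sum>k<N. if k = i then c i (vec_block d i x + t \<cdot>\<^sub>v unit_vec (d i) l)
        else c k (vec_block d k x))"
      unfolding F_def using assms
      by (intro sum.cong) (simp_all add: vec_block_add_unit_vec)
    also have "\<dots> = c i (vec_block d i x + t \<cdot>\<^sub>v unit_vec (d i) l)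
        + (\<Sum>k\<in>{..<N} - {i}. c k (vec_block d k x))"
      using assms(2) by (subst sum.remove[of _ i]) (auto intro!: sum.cong)
    finally show "F t = c i (vec_block d i x + t \<cdot>\<^sub>v unit_vec (d i) l)
        + (\<Sum>k\<in>{..<N} - {i}. c k (vec_block d k x))" .
  qed
  moreover have "((\<lambda>t. c i (vec_block d i x + t \<cdot>\<^sub>v unit_vec (d i) l)) has_real_derivative D) (at 0)"
    using assms(4) unfolding D_def by (simp add: DERIV_deriv_iff_real_differentiable)
  ultimately have F: "(F has_real_derivative D) (at 0)"
    by (auto intro!: derivative_eq_intros)
  then show "F differentiable at 0"
    using real_differentiable_def by blast
  have "partial (\<lambda>y. \<Sum>k<N. c k (vec_block d k y)) x ((\<Sum>k<i. d k) + l) = deriv F 0"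
    using assms by (simp add: partial_def F_def)
  also have "\<dots> = partial (c i) (vec_block d i x) l"
    using F by (simp add: DERIV_imp_deriv D_def partial_def)
  finally show "partial (\<lambda>y. \<Sum>k<N. c k (vec_block d k y)) x ((\<Sum>k<i. d k) + l)
      = partial (c i) (vec_block d i x) l" .
qed

lemma gradient_block_sum:
  assumes "x \<in> carrier_vec (\<Sum>k<N. d k)"
    and "\<And>i l. i < N \<Longrightarrow> l < d i \<Longrightarrow>
      (\<lambda>t. c i (vec_block d i x + t \<cdot>\<^sub>v unit_vec (d i) l)) differentiable at 0"
  shows "gradient (\<lambda>y. \<Sum>k<N. c k (vec_block d k y)) x
    = vec_concat N (\<lambda>i. gradient (c i) (vec_block d i x))"
proof (rule eq_vecI)
  fix j assume "j < dim_vec (vec_concat N (\<lambda>i. gradient (c i) (vec_block d i x)))"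
  then have j: "j < (\<Sum>k<N. d k)"
    by (simp add: gradient_def)
  then obtain i l where il: "i < N" "l < d i" "j = (\<Sum>k<i. d k) + l"
    using block_index_exists by blast
  have "gradient (\<lambda>y. \<Sum>k<N. c k (vec_block d k y)) x $ j
      = partial (\<lambda>y. \<Sum>k<N. c k (vec_block d k y)) x j"
    using assms j by (simp add: gradient_def)
  also have "\<dots> = partial (c i) (vec_block d i x) l"
    unfolding il(3) using assms(2) by (intro partial_block_sum(2) assms il)
  also have "\<dots> = vec_concat N (\<lambda>i. gradient (c i) (vec_block d i x)) $ j"
    unfolding il(3) using il by (subst index_vec_concat) (auto simp: gradient_def)
  finally show "gradient (\<lambda>y. \<Sum>k<N. c k (vec_block d k y)) x $ j
      = vec_concat N (\<lambda>i. gradient (c i) (vec_block d i x)) $ j" .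
qed (use assms in \<open>simp add: gradient_def\<close>)

lemma partial_cmult:
  assumes "(\<lambda>t. g (x + t \<cdot>\<^sub>v unit_vec (dim_vec x) j)) differentiable at 0"
  shows "partial (\<lambda>y. a * g y) x j = a * partial g x j"
  unfolding partial_def using assms
  by (intro DERIV_imp_deriv DERIV_cmult) (simp add: DERIV_deriv_iff_real_differentiable)

lemma gradient_cmult:
  assumes "x \<in> carrier_vec n"
    and "\<And>j. j < n \<Longrightarrow> (\<lambda>t. g (x + t \<cdot>\<^sub>v unit_vec n j)) differentiable at 0"
  shows "gradient (\<lambda>y. a * g y) x = a \<cdot>\<^sub>v gradient g x"
  using assms by (auto simp: gradient_def partial_cmult intro!: eq_vecI)

lemma continuously_differentiable_cmult:
  assumes "continuously_differentiable n n' V"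
  shows "continuously_differentiable n n' (\<lambda>x x'. a * V x x')"
proof -
  have *: "(\<lambda>t. V (x + t \<cdot>\<^sub>v unit_vec n j) x') differentiable at 0"
    if "x \<in> carrier_vec n" "x' \<in> carrier_vec n'" "j < n" for x x' j
    using assms that by (auto simp: continuously_differentiable_def)
  have **: "(\<lambda>t. V x (x' + t \<cdot>\<^sub>v unit_vec n' j)) differentiable at 0"
    if "x \<in> carrier_vec n" "x' \<in> carrier_vec n'" "j < n'" for x x' j
    using assms that by (auto simp: continuously_differentiable_def)
  have "continuous_on (carrier_vec n \<times> carrier_vec n') (\<lambda>(x, x'). partial (\<lambda>y. a * V y x') x j)"
    if "j < n" for j
  proof -
    have "continuous_on (carrier_vec n \<times> carrier_vec n')
        (\<lambda>z. a * (case z of (x, x') \<Rightarrow> partial (\<lambda>y. V y x') x j))"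
      using assms that by (intro continuous_intros) (auto simp: continuously_differentiable_def)
    then show ?thesis
      by (rule continuous_on_eq) (use * that in \<open>auto simp: partial_cmult\<close>)
  qed
  moreover have "continuous_on (carrier_vec n \<times> carrier_vec n')
      (\<lambda>(x, x'). partial (\<lambda>y. a * V x y) x' j)"
    if "j < n'" for j
  proof -
    have "continuous_on (carrier_vec n \<times> carrier_vec n')
        (\<lambda>z. a * (case z of (x, x') \<Rightarrow> partial (\<lambda>y. V x y) x' j))"
      using assms that by (intro continuous_intros) (auto simp: continuously_differentiable_def)
    then show ?thesis
      by (rule continuous_on_eq) (use ** that in \<open>auto simp: partial_cmult\<close>)
  qed
  ultimately show ?thesis
    using * ** by (auto simp: continuously_differentiable_def intro!: differentiable_mult)
qed

lemma continuous_on_vec_blocks: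
  assumes "continuous_on (carrier_vec (d i) \<times> carrier_vec (d' i)) (\<lambda>(x, x'). g x x')" "i < N"
  shows "continuous_on (carrier_vec (\<Sum>k<N. d k) \<times> carrier_vec (\<Sum>k<N. d' k))
    (\<lambda>(x, x'). g (vec_block d i x) (vec_block d' i x'))"
proof -
  let ?U = "carrier_vec (\<Sum>k<N. d k) \<times> carrier_vec (\<Sum>k<N. d' k)"
  have block: "continuous_on (carrier_vec (\<Sum>k<N. d k)) (vec_block d i)" for d
    using lipschitz_on_vec_block[OF assms(2)] by (rule lipschitz_on_continuous_on)
  have "continuous_on ?U (\<lambda>z. (vec_block d i (fst z), vec_block d' i (snd z)))"
    by (intro continuous_on_Pair continuous_on_compose2[OF block] continuous_intros) auto
  from continuous_on_compose2[OF assms(1) this] show ?thesis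
    by (auto simp: case_prod_beta image_subset_iff)
qed

lemma continuously_differentiable_block_sum:
  assumes V: "\<And>i. i < N \<Longrightarrow> continuously_differentiable (d i) (d' i) (V i)"
  shows "continuously_differentiable (\<Sum>k<N. d k) (\<Sum>k<N. d' k)
    (\<lambda>x x'. \<Sum>i<N. V i (vec_block d i x) (vec_block d' i x'))"
proof -
  let ?n = "\<Sum>k<N. d k" and ?n' = "\<Sum>k<N. d' k"
  have diff: "(\<lambda>t. V i (x + t \<cdot>\<^sub>v unit_vec (d i) l) x') differentiable at 0"
    if "i < N" "l < d i" "x \<in> carrier_vec (d i)" "x' \<in> carrier_vec (d' i)" for i l x x'
    using V that by (auto simp: continuously_differentiable_def)
  have diff': "(\<lambda>t. V i x (x' + t \<cdot>\<^sub>v unit_vec (d' i) l)) differentiable at 0"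
    if "i < N" "l < d' i" "x \<in> carrier_vec (d i)" "x' \<in> carrier_vec (d' i)" for i l x x'
    using V that by (auto simp: continuously_differentiable_def)
  have "(\<lambda>t. \<Sum>i<N. V i (vec_block d i (x + t \<cdot>\<^sub>v unit_vec ?n j)) (vec_block d' i x'))
      differentiable at 0"
    if "x \<in> carrier_vec ?n" "j < ?n" for x x' j
    using block_index_exists[OF that(2)] that(1) diff
    by (auto intro!: partial_block_sum(1)[where c = "\<lambda>i y. V i y (vec_block d' i x')"])
  moreover have "(\<lambda>t. \<Sum>i<N. V i (vec_block d i x) (vec_block d' i (x' + t \<cdot>\<^sub>v unit_vec ?n' j)))
      differentiable at 0"
    if "x' \<in> carrier_vec ?n'" "j < ?n'" for x x' j
    using block_index_exists[OF that(2)] that(1) diff'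
    by (auto intro!: partial_block_sum(1)[where c = "\<lambda>i y. V i (vec_block d i x) y"])
  moreover have "continuous_on (carrier_vec ?n \<times> carrier_vec ?n')
      (\<lambda>(x, x'). partial (\<lambda>y. \<Sum>i<N. V i (vec_block d i y) (vec_block d' i x')) x j)"
    if "j < ?n" for j
  proof -
    obtain i l where il: "i < N" "l < d i" "j = (\<Sum>k<i. d k) + l"
      using block_index_exists \<open>j < ?n\<close> by blast
    have "continuous_on (carrier_vec ?n \<times> carrier_vec ?n')
        (\<lambda>(x, x'). partial (\<lambda>y. V i y (vec_block d' i x')) (vec_block d i x) l)"
      using V il by (intro continuous_on_vec_blocks[where g = "\<lambda>x x'. partial (\<lambda>y. V i y x') x l"])
        (auto simp: continuously_differentiable_def)
    moreover have "partial (\<lambda>y. \<Sum>i<N. V i (vec_block d i y) (vec_block d' i x')) x j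
        = partial (\<lambda>y. V i y (vec_block d' i x')) (vec_block d i x) l"
      if "x \<in> carrier_vec ?n" for x x'
      unfolding il(3) using il that diff
      by (intro partial_block_sum(2)[where c = "\<lambda>i y. V i y (vec_block d' i x')"]) auto
    ultimately show ?thesis
      by (auto elim!: continuous_on_eq)
  qed
  moreover have "continuous_on (carrier_vec ?n \<times> carrier_vec ?n')
      (\<lambda>(x, x'). partial (\<lambda>y. \<Sum>i<N. V i (vec_block d i x) (vec_block d' i y)) x' j)"
    if "j < ?n'" for j
  proof -
    obtain i l where il: "i < N" "l < d' i" "j = (\<Sum>k<i. d' k) + l"
      using block_index_exists \<open>j < ?n'\<close> by blast
    have "continuous_on (carrier_vec ?n \<times> carrier_vec ?n')
        (\<lambda>(x, x'). partial (\<lambda>y. V i (vec_block d i x) y) (vec_block d' i x') l)"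
      using V il by (intro continuous_on_vec_blocks[where g = "\<lambda>x x'. partial (\<lambda>y. V i x y) x' l"])
        (auto simp: continuously_differentiable_def)
    moreover have "partial (\<lambda>y. \<Sum>i<N. V i (vec_block d i x) (vec_block d' i y)) x' j
        = partial (\<lambda>y. V i (vec_block d i x) y) (vec_block d' i x') l"
      if "x' \<in> carrier_vec ?n'" for x x'
      unfolding il(3) using il that diff'
      by (intro partial_block_sum(2)[where c = "\<lambda>i y. V i (vec_block d i x) y"]) auto
    ultimately show ?thesis
      by (auto elim!: continuous_on_eq)
  qed
  ultimately show ?thesis
    by (simp add: continuously_differentiable_def)
qed

section \<open>Block matrices and quadratic forms\<close>

lemma block_diag_0 [simp]: "block_diag 0 A = 0\<^sub>m 0 0"
  by (simp add: block_diag_def)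

lemma block_diag_Suc: "block_diag (Suc N) A = four_block_mat (block_diag N A)
    (0\<^sub>m (dim_row (block_diag N A)) (dim_col (A N)))
    (0\<^sub>m (dim_row (A N)) (dim_col (block_diag N A))) (A N)"
  by (simp add: block_diag_def diag_block_mat_last Let_def)

lemma dim_block_diag [simp]:
  "dim_row (block_diag N A) = (\<Sum>i<N. dim_row (A i))"
  "dim_col (block_diag N A) = (\<Sum>i<N. dim_col (A i))"
  by (induction N) (simp_all add: block_diag_Suc)

lemma block_diag_carrier:
  assumes "\<And>i. i < N \<Longrightarrow> A i \<in> carrier_mat (nr i) (nc i)"
  shows "block_diag N A \<in> carrier_mat (\<Sum>i<N. nr i) (\<Sum>i<N. nc i)"
  using assms by (intro carrier_matI) (simp_all add: carrier_matD[OF assms])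

lemma block_diag_mult_vec_concat:
  assumes "\<And>i. i < N \<Longrightarrow> dim_vec (x i) = dim_col (A i)"
  shows "block_diag N A *\<^sub>v vec_concat N x = vec_concat N (\<lambda>i. A i *\<^sub>v x i)"
  using assms
proof (induction N)
  case (Suc N)
  have x: "vec_concat N x \<in> carrier_vec (dim_col (block_diag N A))"
      "x N \<in> carrier_vec (dim_col (A N))"
    using Suc.prems by (auto intro!: carrier_vecI sum.cong)
  then have "block_diag (Suc N) A *\<^sub>v vec_concat (Suc N) x
      = (block_diag N A *\<^sub>v vec_concat N x) @\<^sub>v (A N *\<^sub>v x N)"
    unfolding block_diag_Suc vec_concat_Suc
    by (subst four_block_mat_mult_vec[of "block_diag N A" "dim_row (block_diag N A)" _ _
          "dim_col (A N)" _ "dim_row (A N)"])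
      (auto intro!: arg_cong2[of _ _ _ _ "(@\<^sub>v)"] right_zero_vec left_zero_vec)
  then show ?case
    using Suc by (simp add: vec_concat_Suc)
qed (auto intro!: eq_vecI)

lemma zero_mult_mat_vec:
  "(x :: real vec) \<in> carrier_vec nc \<Longrightarrow> 0\<^sub>m nr nc *\<^sub>v x = 0\<^sub>v nr"
  by (intro eq_vecI) auto

lemma quad_form_four_block:
  assumes "A \<in> carrier_mat n n" "B \<in> carrier_mat n m" "C \<in> carrier_mat m n" "D \<in> carrier_mat m m"
    and "a \<in> carrier_vec n" "b \<in> carrier_vec m"
  shows "quad_form (four_block_mat A B C D) (a @\<^sub>v b)
    = a \<bullet> (A *\<^sub>v a) + a \<bullet> (B *\<^sub>v b) + b \<bullet> (C *\<^sub>v a) + b \<bullet> (D *\<^sub>v b)"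
  using assms
  by (simp add: quad_form_def four_block_mat_mult_vec[OF assms] scalar_prod_append'
      scalar_prod_add_distrib[of _ n] scalar_prod_add_distrib[of _ m])

text \<open>
  The blocks may be rectangular, as they are in the off-diagonal parts of \<open>block_X\<close>.
\<close>

lemma scalar_prod_block_diag:
  assumes "\<And>i. i < N \<Longrightarrow> A i \<in> carrier_mat (nr i) (nc i)"
    and "\<And>i. i < N \<Longrightarrow> a i \<in> carrier_vec (nr i)" "\<And>i. i < N \<Longrightarrow> b i \<in> carrier_vec (nc i)"
  shows "vec_concat N a \<bullet> (block_diag N (\<lambda>i. \<mu> i \<cdot>\<^sub>m A i) *\<^sub>v vec_concat N b)
    = (\<Sum>i<N. \<mu> i * (a i \<bullet> (A i *\<^sub>v b i)))"
proof -
  have dim: "dim_row (A i) = nr i" "dim_col (A i) = nc i"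
      "dim_vec (a i) = nr i" "dim_vec (b i) = nc i"
    if "i < N" for i
    using assms that by auto
  have "vec_concat N a \<bullet> (block_diag N (\<lambda>i. \<mu> i \<cdot>\<^sub>m A i) *\<^sub>v vec_concat N b)
      = (\<Sum>i<N. a i \<bullet> ((\<mu> i \<cdot>\<^sub>m A i) *\<^sub>v b i))"
    by (simp add: block_diag_mult_vec_concat scalar_prod_vec_concat dim)
  also have "\<dots> = (\<Sum>i<N. \<mu> i * (a i \<bullet> (A i *\<^sub>v b i)))"
  proof (rule sum.cong)
    fix i assume "i \<in> {..<N}"
    then have "(\<mu> i \<cdot>\<^sub>m A i) *\<^sub>v b i = \<mu> i \<cdot>\<^sub>v (A i *\<^sub>v b i)"
      using dim[of i] by (auto intro!: eq_vecI simp: row_smult)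
    then show "a i \<bullet> ((\<mu> i \<cdot>\<^sub>m A i) *\<^sub>v b i) = \<mu> i * (a i \<bullet> (A i *\<^sub>v b i))"
      using dim[of i] \<open>i \<in> {..<N}\<close> by simp
  qed simp
  finally show ?thesis .
qed

text \<open>
  \<open>block_X\<close> groups the rows and columns of the \<open>X i\<close> by kind (internal input or internal output)
  rather than by subsystem. Its argument is grouped in the same way, so the form is the weighted
  sum of the supply rates of the subsystems.
\<close>

lemma quad_form_block_X:
  assumes X: "\<And>i. i < N \<Longrightarrow> X11 i \<in> carrier_mat (r i) (r i)"
      "\<And>i. i < N \<Longrightarrow> X12 i \<in> carrier_mat (r i) (q i)"
      "\<And>i. i < N \<Longrightarrow> X21 i \<in> carrier_mat (q i) (r i)"
      "\<And>i. i < N \<Longrightarrow> X22 i \<in> carrier_mat (q i) (q i)"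
    and ab: "\<And>i. i < N \<Longrightarrow> a i \<in> carrier_vec (r i)" "\<And>i. i < N \<Longrightarrow> b i \<in> carrier_vec (q i)"
  shows "quad_form (block_X N \<mu> X11 X12 X21 X22) (vec_concat N a @\<^sub>v vec_concat N b)
    = (\<Sum>i<N. \<mu> i * quad_form (four_block_mat (X11 i) (X12 i) (X21 i) (X22 i)) (a i @\<^sub>v b i))"
proof -
  have "block_diag N (\<lambda>i. \<mu> i \<cdot>\<^sub>m A i) \<in> carrier_mat (\<Sum>i<N. nr i) (\<Sum>i<N. nc i)"
    if "\<And>i. i < N \<Longrightarrow> A i \<in> carrier_mat (nr i) (nc i)" for A nr nc
    using that by (intro block_diag_carrier) auto
  note carrier = this[of X11 r r, OF X(1)] this[of X12 r q, OF X(2)]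
    this[of X21 q r, OF X(3)] this[of X22 q q, OF X(4)]
  have "quad_form (block_X N \<mu> X11 X12 X21 X22) (vec_concat N a @\<^sub>v vec_concat N b)
      = (\<Sum>i<N. \<mu> i * (a i \<bullet> (X11 i *\<^sub>v a i))) + (\<Sum>i<N. \<mu> i * (a i \<bullet> (X12 i *\<^sub>v b i)))
        + (\<Sum>i<N. \<mu> i * (b i \<bullet> (X21 i *\<^sub>v a i))) + (\<Sum>i<N. \<mu> i * (b i \<bullet> (X22 i *\<^sub>v b i)))"
    unfolding block_X_def
    by (simp add: quad_form_four_block[OF carrier
            vec_concat_carrier[OF ab(1)] vec_concat_carrier[OF ab(2)]]
        scalar_prod_block_diag[OF X(1) ab(1) ab(1)] scalar_prod_block_diag[OF X(2) ab(1) ab(2)]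
        scalar_prod_block_diag[OF X(3) ab(2) ab(1)] scalar_prod_block_diag[OF X(4) ab(2) ab(2)])
  also have "\<dots> = (\<Sum>i<N. \<mu> i * (a i \<bullet> (X11 i *\<^sub>v a i) + a i \<bullet> (X12 i *\<^sub>v b i)
      + b i \<bullet> (X21 i *\<^sub>v a i) + b i \<bullet> (X22 i *\<^sub>v b i)))"
    by (simp add: sum.distrib distrib_left)
  also have "\<dots> = (\<Sum>i<N. \<mu> i *
      quad_form (four_block_mat (X11 i) (X12 i) (X21 i) (X22 i)) (a i @\<^sub>v b i))"
    using quad_form_four_block[OF X ab] by (intro sum.cong) auto
  finally show ?thesis .
qed

lemma quad_form_diff:
  assumes "A \<in> carrier_mat n n" "B \<in> carrier_mat n n" "x \<in> carrier_vec n"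
  shows "quad_form (A - B) x = quad_form A x - quad_form B x"
  using assms
  by (simp add: quad_form_def minus_mult_distrib_mat_vec scalar_prod_minus_distrib[of _ n])

lemma quad_form_congruence:
  assumes T: "T \<in> carrier_mat m n" and X: "X \<in> carrier_mat m m" and x: "x \<in> carrier_vec n"
  shows "quad_form (transpose_mat T * X * T) x = quad_form X (T *\<^sub>v x)"
proof -
  have "(transpose_mat T * X * T) *\<^sub>v x = (transpose_mat T * X) *\<^sub>v (T *\<^sub>v x)"
    using assms by (intro assoc_mult_mat_vec[of _ n m]) auto
  also have "\<dots> = transpose_mat T *\<^sub>v (X *\<^sub>v (T *\<^sub>v x))"
    using assms by (intro assoc_mult_mat_vec[of _ n m]) auto
  finally have "(transpose_mat T * X * T) *\<^sub>v x = transpose_mat T *\<^sub>v (X *\<^sub>v (T *\<^sub>v x))" .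
  then show ?thesis
    using transpose_vec_mult_scalar[OF T x, of "X *\<^sub>v (T *\<^sub>v x)"] assms
    by (simp add: quad_form_def comm_scalar_prod[of _ n] comm_scalar_prod[of _ m])
qed

text \<open>The quadratic form of \<open>T\<^sup>T X T\<close> at \<open>x\<close> is that of \<open>X\<close> at \<open>T x\<close>.\<close>

lemma semidef_le_congruence_bound:
  assumes LMI: "semidef_le n (transpose_mat T * X * T - Z) (0\<^sub>m n n)"
    and T: "T \<in> carrier_mat m n" and X: "X \<in> carrier_mat m m" and Z: "Z \<in> carrier_mat n n"
    and x: "x \<in> carrier_vec n"
  shows "quad_form X (T *\<^sub>v x) \<le> quad_form Z x"
proof -
  let ?A = "transpose_mat T * X * T"
  have A: "?A \<in> carrier_mat n n"
    using T X by auto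
  have "0 \<le> quad_form (0\<^sub>m n n - (?A - Z)) x"
    using LMI x by (simp add: semidef_le_def)
  also have "\<dots> = quad_form (0\<^sub>m n n) x - (quad_form ?A x - quad_form Z x)"
    using quad_form_diff[OF zero_carrier_mat minus_carrier_mat[OF Z] x, of ?A]
      quad_form_diff[OF A Z x] by simp
  also have "quad_form (0\<^sub>m n n) x = 0"
    using x by (simp add: quad_form_def zero_mult_mat_vec)
  finally show ?thesis
    using quad_form_congruence[OF T X x] by simp
qed

section \<open>The interconnected system\<close>

lemma stacked_h2_carrier:
  assumes "\<And>i. i < N \<Longrightarrow> control_subsystem (S i)"
  shows "stacked_h2 N S x \<in> carrier_vec (\<Sum>i<N. sub_q2 (S i))"
  using assms unfolding stacked_h2_def control_subsystem_def by (intro vec_concat_carrier) auto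

text \<open>
  The internal input of every subsystem depends on the whole state through the internal outputs.
  This is where local Lipschitz continuity of \<open>sub_h2\<close> enters, in addition to that of \<open>sub_f\<close>.
\<close>

lemma control_system_interconnection:
  assumes S: "\<And>i. i < N \<Longrightarrow> control_subsystem (S i)"
    and M: "M \<in> carrier_mat (\<Sum>i<N. sub_p (S i)) (\<Sum>i<N. sub_q2 (S i))"
  shows "control_system (interconnection N S M)"
proof -
  define n m p where nmp: "n = (\<lambda>i. sub_n (S i))" "m = (\<lambda>i. sub_m (S i))" "p = (\<lambda>i. sub_p (S i))"
  define U where "U = (carrier_vec (\<Sum>i<N. n i) :: real vec set) \<times>
    (carrier_vec (\<Sum>i<N. m i) :: real vec set)"
  let ?f = "\<lambda>i x u. sub_f (S i) (vec_block n i x) (vec_block m i u)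
      (vec_block p i (M *\<^sub>v stacked_h2 N S x))"
  have state: "locally_lipschitz_on U (\<lambda>z. vec_block n i (fst z))"
    and input: "locally_lipschitz_on U (\<lambda>z. vec_block m i (snd z))" if "i < N" for i
    using that by (auto intro!: locally_lipschitz_on_vec_block simp: U_def)
  have "locally_lipschitz_on U (\<lambda>z. sub_h2 (S i) (vec_block n i (fst z)))" if "i < N" for i
    using S[OF that]
    by (intro locally_lipschitz_on_compose[OF state[OF that], of "carrier_vec (n i)"])
      (auto simp: control_subsystem_def nmp)
  then have "locally_lipschitz_on U (\<lambda>z. stacked_h2 N S (fst z))"
    unfolding stacked_h2_def using S
    by (intro locally_lipschitz_on_vec_concat[where d = "\<lambda>i. sub_q2 (S i)"])
      (auto simp: control_subsystem_def nmp)
  then have Mh: "locally_lipschitz_on U (\<lambda>z. M *\<^sub>v stacked_h2 N S (fst z))"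
    using stacked_h2_carrier[OF S]
    by (intro locally_lipschitz_on_compose[OF _
          locally_lipschitz_on_lipschitz_on[OF lipschitz_on_mult_mat_vec[OF M]]]) auto
  have internal: "locally_lipschitz_on U (\<lambda>z. vec_block p i (M *\<^sub>v stacked_h2 N S (fst z)))"
    if "i < N" for i
    using that mult_mat_vec_carrier[OF M stacked_h2_carrier[OF S]] unfolding nmp
    by (intro locally_lipschitz_on_vec_block[OF Mh]) auto
  have f: "locally_lipschitz_on U (\<lambda>z. ?f i (fst z) (snd z))" if "i < N" for i
  proof -
    have "locally_lipschitz_on U (\<lambda>z. (\<lambda>(x, u, w). sub_f (S i) x u w) (vec_block n i (fst z),
        vec_block m i (snd z), vec_block p i (M *\<^sub>v stacked_h2 N S (fst z))))"
      using S[OF that]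
      by (intro locally_lipschitz_on_compose[OF
            locally_lipschitz_on_Pair[OF state[OF that]
              locally_lipschitz_on_Pair[OF input[OF that] internal[OF that]]],
            of "carrier_vec (n i) \<times> carrier_vec (m i) \<times> carrier_vec (p i)"])
        (auto simp: control_subsystem_def nmp)
    then show ?thesis
      by simp
  qed
  have f_carrier: "?f i x u \<in> carrier_vec (n i)" if "i < N" for i x u
    using S[OF that] by (simp add: control_subsystem_def nmp)
  have "locally_lipschitz_on U (\<lambda>z. vec_concat N (\<lambda>i. ?f i (fst z) (snd z)))"
    using f f_carrier by (rule locally_lipschitz_on_vec_concat)
  then have "locally_lipschitz_on U (\<lambda>(x, u). vec_concat N (\<lambda>i. ?f i x u))"
    by (simp only: case_prod_unfold)
  moreover have "vec_concat N (\<lambda>i. ?f i x u) \<in> carrier_vec (\<Sum>i<N. n i)" for x u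
    using f_carrier by (rule vec_concat_carrier)
  moreover have "vec_concat N (\<lambda>i. sub_h1 (S i) (vec_block n i x))
      \<in> carrier_vec (\<Sum>i<N. sub_q1 (S i))" for x
    using S by (intro vec_concat_carrier) (simp add: control_subsystem_def nmp)
  ultimately show ?thesis
    by (simp add: control_system_def interconnection_def Let_def U_def nmp)
qed

lemma locally_lipschitz_on_interfaces:
  assumes v: "\<And>i. i < N \<Longrightarrow> locally_lipschitz_on
      (carrier_vec (n i) \<times> carrier_vec (n' i) \<times> carrier_vec (m' i)) (\<lambda>(x, x', u'). v i x x' u')"
    and carrier: "\<And>i x x' u'. i < N \<Longrightarrow> x \<in> carrier_vec (n i) \<Longrightarrow> x' \<in> carrier_vec (n' i) \<Longrightarrow>
      u' \<in> carrier_vec (m' i) \<Longrightarrow> v i x x' u' \<in> carrier_vec (m i)"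
  shows "locally_lipschitz_on (carrier_vec (\<Sum>i<N. n i) \<times> carrier_vec (\<Sum>i<N. n' i) \<times>
      carrier_vec (\<Sum>i<N. m' i))
    (\<lambda>(x, x', u'). vec_concat N (\<lambda>i. v i (vec_block n i x) (vec_block n' i x') (vec_block m' i u')))"
proof -
  define U where "U = (carrier_vec (\<Sum>i<N. n i) :: real vec set) \<times>
    (carrier_vec (\<Sum>i<N. n' i) :: real vec set) \<times> (carrier_vec (\<Sum>i<N. m' i) :: real vec set)"
  have snd: "locally_lipschitz_on U (\<lambda>z. fst (snd z))" "locally_lipschitz_on U (\<lambda>z. snd (snd z))"
    by (auto intro: locally_lipschitz_on_compose[of U snd UNIV])
  have blocks: "locally_lipschitz_on U (\<lambda>z. vec_block n i (fst z))"
    "locally_lipschitz_on U (\<lambda>z. vec_block n' i (fst (snd z)))"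
    "locally_lipschitz_on U (\<lambda>z. vec_block m' i (snd (snd z)))" if "i < N" for i
    using that snd by (auto intro!: locally_lipschitz_on_vec_block simp: U_def)
  have "locally_lipschitz_on U (\<lambda>z. (\<lambda>(x, x', u'). v i x x' u') (vec_block n i (fst z),
      vec_block n' i (fst (snd z)), vec_block m' i (snd (snd z))))" if "i < N" for i
    by (intro locally_lipschitz_on_compose[OF _ v[OF that]] locally_lipschitz_on_Pair
        blocks[OF that]) auto
  then have "locally_lipschitz_on U (\<lambda>z. vec_concat N (\<lambda>i. v i (vec_block n i (fst z))
      (vec_block n' i (fst (snd z))) (vec_block m' i (snd (snd z)))))"
    using carrier by (intro locally_lipschitz_on_vec_concat[where d = m]) auto
  then show ?thesis
    by (simp add: case_prod_unfold U_def)
qed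

text \<open>
  The algebraic core. The error signals of the supply rates, stacked, are the image of
  \<open>[y'; y - H y']\<close> under the block matrix of the linear matrix inequality: the part of
  \<open>W w - W' w'\<close> that is not \<open>W M (y - H y')\<close> is \<open>Y y'\<close>, by the definition of \<open>Y\<close>. As the corner
  \<open>Z\<close> only sees the first block of that vector, what remains is a quantity of the abstraction alone.
\<close>

lemma coupled_supply_bound:
  fixes Wi Wi' Hi X11 X12 X21 X22 :: "nat \<Rightarrow> real mat"
  assumes dims: "\<And>i. i < N \<Longrightarrow> Wi i \<in> carrier_mat (rd i) (pd i)"
      "\<And>i. i < N \<Longrightarrow> Wi' i \<in> carrier_mat (rd i) (pd' i)"
      "\<And>i. i < N \<Longrightarrow> Hi i \<in> carrier_mat (qd i) (qd' i)"
    and X: "\<And>i. i < N \<Longrightarrow> X11 i \<in> carrier_mat (rd i) (rd i)"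
      "\<And>i. i < N \<Longrightarrow> X12 i \<in> carrier_mat (rd i) (qd i)"
      "\<And>i. i < N \<Longrightarrow> X21 i \<in> carrier_mat (qd i) (rd i)"
      "\<And>i. i < N \<Longrightarrow> X22 i \<in> carrier_mat (qd i) (qd i)"
    and defs: "W = block_diag N Wi" "W' = block_diag N Wi'" "H = block_diag N Hi"
      "Y = W * M * H - W' * M'" "q = (\<Sum>i<N. qd i)" "q' = (\<Sum>i<N. qd' i)"
    and M: "M \<in> carrier_mat (\<Sum>i<N. pd i) q" and M': "M' \<in> carrier_mat (\<Sum>i<N. pd' i) q'"
    and Z: "Z \<in> carrier_mat q' q'"
    and LMI: "semidef_le (q' + q)
      (transpose_mat (four_block_mat Y (W * M) (0\<^sub>m q q') (1\<^sub>m q))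
          * block_X N \<mu> X11 X12 X21 X22
          * four_block_mat Y (W * M) (0\<^sub>m q q') (1\<^sub>m q)
        - four_block_mat Z (0\<^sub>m q' q) (0\<^sub>m q q') (0\<^sub>m q q))
      (0\<^sub>m (q' + q) (q' + q))"
    and y: "\<And>i. i < N \<Longrightarrow> y i \<in> carrier_vec (qd i)"
      "\<And>i. i < N \<Longrightarrow> y' i \<in> carrier_vec (qd' i)"
    and w: "w = M *\<^sub>v vec_concat N y" "w' = M' *\<^sub>v vec_concat N y'"
  shows "(\<Sum>i<N. \<mu> i * quad_form (four_block_mat (X11 i) (X12 i) (X21 i) (X22 i))
      ((Wi i *\<^sub>v vec_block pd i w - Wi' i *\<^sub>v vec_block pd' i w') @\<^sub>v (y i - Hi i *\<^sub>v y' i)))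
    \<le> quad_form Z (vec_concat N y')"
proof -
  let ?r = "\<Sum>i<N. rd i" and ?p = "\<Sum>i<N. pd i" and ?p' = "\<Sum>i<N. pd' i"
  let ?Y = "vec_concat N y" and ?Y' = "vec_concat N y'"
  define a where "a = (\<lambda>i. Wi i *\<^sub>v vec_block pd i w - Wi' i *\<^sub>v vec_block pd' i w')"
  define b where "b = (\<lambda>i. y i - Hi i *\<^sub>v y' i)"
  define T where "T = four_block_mat Y (W * M) (0\<^sub>m q q') (1\<^sub>m q)"
  have W: "W \<in> carrier_mat ?r ?p" and W': "W' \<in> carrier_mat ?r ?p'" and H: "H \<in> carrier_mat q q'"
    using dims unfolding defs by (auto intro!: block_diag_carrier)
  have WM: "W * M \<in> carrier_mat ?r q" and WM': "W' * M' \<in> carrier_mat ?r q'"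
    and WMH: "W * M * H \<in> carrier_mat ?r q'" and Y: "Y \<in> carrier_mat ?r q'"
    using W W' H M M' unfolding defs(4) by auto
  have yc: "?Y \<in> carrier_vec q" "?Y' \<in> carrier_vec q'"
    using y unfolding defs by (auto intro!: vec_concat_carrier)
  have wc: "w \<in> carrier_vec ?p" "w' \<in> carrier_vec ?p'"
    using M M' yc unfolding w by auto
  have ab: "a i \<in> carrier_vec (rd i)" "b i \<in> carrier_vec (qd i)" if "i < N" for i
    using dims[OF that] y[OF that] by (auto simp: a_def b_def)
  have Hi_dim: "dim_row (Hi i) = qd i" "dim_col (Hi i) = qd' i" "dim_vec (y i) = qd i"
      "dim_vec (y' i) = qd' i" if "i < N" for i
    using dims(3)[OF that] y[OF that] by auto
  have Hy: "H *\<^sub>v ?Y' = vec_concat N (\<lambda>i. Hi i *\<^sub>v y' i)"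
    unfolding defs by (intro block_diag_mult_vec_concat) (simp add: Hi_dim)
  have b: "vec_concat N b = ?Y - H *\<^sub>v ?Y'"
    unfolding b_def Hy by (intro vec_concat_diff[symmetric]) (simp add: Hi_dim)
  have bc: "?Y - H *\<^sub>v ?Y' \<in> carrier_vec q"
    using yc H by auto
  have Wi_dim: "dim_row (Wi i) = rd i" "dim_col (Wi i) = pd i" "dim_row (Wi' i) = rd i"
      "dim_col (Wi' i) = pd' i" if "i < N" for i
    using dims(1,2)[OF that] by auto
  have "vec_concat N a = vec_concat N (\<lambda>i. Wi i *\<^sub>v vec_block pd i w)
      - vec_concat N (\<lambda>i. Wi' i *\<^sub>v vec_block pd' i w')"
    unfolding a_def by (intro vec_concat_diff[symmetric]) (simp add: Wi_dim)
  also have "vec_concat N (\<lambda>i. Wi i *\<^sub>v vec_block pd i w)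
      = W *\<^sub>v vec_concat N (\<lambda>i. vec_block pd i w)"
    unfolding defs by (intro block_diag_mult_vec_concat[symmetric]) (simp add: Wi_dim)
  also have "vec_concat N (\<lambda>i. Wi' i *\<^sub>v vec_block pd' i w')
      = W' *\<^sub>v vec_concat N (\<lambda>i. vec_block pd' i w')"
    unfolding defs by (intro block_diag_mult_vec_concat[symmetric]) (simp add: Wi_dim)
  finally have "vec_concat N a = W *\<^sub>v w - W' *\<^sub>v w'"
    using wc by (simp add: vec_concat_vec_block)
  also have "\<dots> = (W * M) *\<^sub>v ?Y - (W' * M') *\<^sub>v ?Y'"
    unfolding w using W W' M M' yc by (simp add: assoc_mult_mat_vec)
  also have "(W * M) *\<^sub>v ?Y = (W * M * H) *\<^sub>v ?Y' + (W * M) *\<^sub>v (?Y - H *\<^sub>v ?Y')"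
  proof -
    have "(W * M) *\<^sub>v (?Y - H *\<^sub>v ?Y') = (W * M) *\<^sub>v ?Y - (W * M) *\<^sub>v (H *\<^sub>v ?Y')"
      using WM yc H by (intro mult_minus_distrib_mat_vec) auto
    moreover have "(W * M) *\<^sub>v (H *\<^sub>v ?Y') = (W * M * H) *\<^sub>v ?Y'"
      using WM yc H by (intro assoc_mult_mat_vec[symmetric]) auto
    ultimately show ?thesis
      using WM WMH by (auto intro!: eq_vecI)
  qed
  also have "(W * M * H) *\<^sub>v ?Y' + (W * M) *\<^sub>v (?Y - H *\<^sub>v ?Y') - (W' * M') *\<^sub>v ?Y'
      = Y *\<^sub>v ?Y' + (W * M) *\<^sub>v (?Y - H *\<^sub>v ?Y')"
  proof -
    have "Y *\<^sub>v ?Y' = (W * M * H) *\<^sub>v ?Y' - (W' * M') *\<^sub>v ?Y'"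
      unfolding defs(4) using WMH WM' yc by (intro minus_mult_distrib_mat_vec) auto
    moreover have "t + u - s = t - s + u"
      if "t \<in> carrier_vec ?r" "u \<in> carrier_vec ?r" "s \<in> carrier_vec ?r" for s t u :: "real vec"
      using that by (auto intro!: eq_vecI)
    moreover have "(W * M * H) *\<^sub>v ?Y' \<in> carrier_vec ?r" "(W' * M') *\<^sub>v ?Y' \<in> carrier_vec ?r"
        "(W * M) *\<^sub>v (?Y - H *\<^sub>v ?Y') \<in> carrier_vec ?r"
      using mult_mat_vec_carrier[OF WMH yc(2)] mult_mat_vec_carrier[OF WM' yc(2)]
        mult_mat_vec_carrier[OF WM bc] by simp_all
    ultimately show ?thesis
      by metis
  qed
  finally have a: "vec_concat N a = Y *\<^sub>v ?Y' + (W * M) *\<^sub>v (?Y - H *\<^sub>v ?Y')" .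
  have "T *\<^sub>v (?Y' @\<^sub>v (?Y - H *\<^sub>v ?Y'))
      = (Y *\<^sub>v ?Y' + (W * M) *\<^sub>v (?Y - H *\<^sub>v ?Y'))
        @\<^sub>v (0\<^sub>m q q' *\<^sub>v ?Y' + 1\<^sub>m q *\<^sub>v (?Y - H *\<^sub>v ?Y'))"
    unfolding T_def
    by (rule four_block_mat_mult_vec[OF Y WM zero_carrier_mat one_carrier_mat yc(2) bc])
  also have "0\<^sub>m q q' *\<^sub>v ?Y' + 1\<^sub>m q *\<^sub>v (?Y - H *\<^sub>v ?Y') = ?Y - H *\<^sub>v ?Y'"
    using yc bc by (simp add: zero_mult_mat_vec)
  finally have T_eq: "T *\<^sub>v (?Y' @\<^sub>v (?Y - H *\<^sub>v ?Y')) = vec_concat N a @\<^sub>v vec_concat N b"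
    unfolding a b .
  have Tc: "T \<in> carrier_mat (?r + q) (q' + q)"
    unfolding T_def using Y by (intro four_block_carrier_mat) auto
  have Xc: "block_X N \<mu> X11 X12 X21 X22 \<in> carrier_mat (?r + q) (?r + q)"
    unfolding block_X_def defs using X
    by (intro four_block_carrier_mat block_diag_carrier) auto
  have Zc: "four_block_mat Z (0\<^sub>m q' q) (0\<^sub>m q q') (0\<^sub>m q q) \<in> carrier_mat (q' + q) (q' + q)"
    using Z by (intro four_block_carrier_mat) auto
  have "quad_form (block_X N \<mu> X11 X12 X21 X22) (vec_concat N a @\<^sub>v vec_concat N b)
      \<le> quad_form (four_block_mat Z (0\<^sub>m q' q) (0\<^sub>m q q') (0\<^sub>m q q)) (?Y' @\<^sub>v (?Y - H *\<^sub>v ?Y'))"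
    unfolding T_eq[symmetric]
    by (rule semidef_le_congruence_bound[OF LMI[folded T_def] Tc Xc Zc
          append_carrier_vec[OF yc(2) bc]])
  also have "\<dots> = quad_form Z ?Y'"
    using quad_form_four_block[OF Z zero_carrier_mat zero_carrier_mat zero_carrier_mat yc(2) bc] yc bc
    by (simp add: quad_form_def zero_mult_mat_vec)
  finally show ?thesis
    using quad_form_block_X[OF X ab, of N "\<lambda>i. i"]
    unfolding a_def b_def by simp
qed


text \<open>
  The chain rule along an interconnection: the dynamics are concatenations, so the derivative of a
  weighted sum splits into the derivatives along the subsystems.
\<close>

lemma gradient_block_sum_scalar_prod:
  assumes x: "x \<in> carrier_vec (\<Sum>k<N. d k)"
    and diff: "\<And>i l. i < N \<Longrightarrow> l < d i \<Longrightarrow>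
      (\<lambda>t. g i (vec_block d i x + t \<cdot>\<^sub>v unit_vec (d i) l)) differentiable at 0"
    and f: "\<And>i. i < N \<Longrightarrow> f i \<in> carrier_vec (d i)"
  shows "gradient (\<lambda>y. \<Sum>i<N. \<mu> i * g i (vec_block d i y)) x \<bullet> vec_concat N f
    = (\<Sum>i<N. \<mu> i * (gradient (g i) (vec_block d i x) \<bullet> f i))"
proof -
  have "gradient (\<lambda>y. \<Sum>i<N. \<mu> i * g i (vec_block d i y)) x
      = vec_concat N (\<lambda>i. gradient (\<lambda>y. \<mu> i * g i y) (vec_block d i x))"
    using x diff
    by (intro gradient_block_sum[where c = "\<lambda>i y. \<mu> i * g i y"] differentiable_mult) auto
  also have "\<dots> = vec_concat N (\<lambda>i. \<mu> i \<cdot>\<^sub>v gradient (g i) (vec_block d i x))"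
    using diff by (intro vec_concat_cong gradient_cmult[OF vec_block_carrier[OF refl]]) auto
  finally have grad: "gradient (\<lambda>y. \<Sum>i<N. \<mu> i * g i (vec_block d i y)) x
      = vec_concat N (\<lambda>i. \<mu> i \<cdot>\<^sub>v gradient (g i) (vec_block d i x))" .
  have dim: "dim_vec (f i) = d i" if "i < N" for i
    using f[OF that] by simp
  show ?thesis
    unfolding grad by (subst scalar_prod_vec_concat) (simp_all add: gradient_def dim)
qed

theorem theorem4:
  fixes N :: nat
    and S S' :: "nat \<Rightarrow> subsystem"
    and V :: "nat \<Rightarrow> real vec \<Rightarrow> real vec \<Rightarrow> real"
    and v :: "nat \<Rightarrow> real vec \<Rightarrow> real vec \<Rightarrow> real vec \<Rightarrow> real vec"
    and \<nu> \<eta> \<rho> :: "nat \<Rightarrow> real \<Rightarrow> real"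
    and \<Delta> :: "nat \<Rightarrow> real vec \<Rightarrow> real"
    and Wi Wi' Hi X11 X12 X21 X22 :: "nat \<Rightarrow> real mat"
    and W W' H M M' Y Z :: "real mat"
    and \<mu> \<mu>' :: "nat \<Rightarrow> real"
    and r q q' :: nat
  assumes storage: "\<And>i. i < N \<Longrightarrow>
      practical_storage_function (S' i) (S i) (V i) (v i) (\<nu> i) (\<eta> i) (\<rho> i) (\<Delta> i)
        (Wi i) (Wi' i) (Hi i) (X11 i) (X12 i) (X21 i) (X22 i)"
    and W_def: "W = block_diag N Wi"
    and W'_def: "W' = block_diag N Wi'"
    and H_def: "H = block_diag N Hi"
    and r_def: "r = (\<Sum>i<N. dim_row (Wi i))"
    and q_def: "q = (\<Sum>i<N. sub_q2 (S i))"
    and q'_def: "q' = (\<Sum>i<N. sub_q2 (S' i))"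
    and M: "M \<in> carrier_mat (\<Sum>i<N. sub_p (S i)) q"
    and \<mu>'_pos: "\<And>i. i < N \<Longrightarrow> 0 < \<mu>' i"
    and LMI_M: "semidef_le q
      (transpose_mat (W * M @\<^sub>r 1\<^sub>m q) * block_X N \<mu>' X11 X12 X21 X22 * (W * M @\<^sub>r 1\<^sub>m q))
      (0\<^sub>m q q)"
    and M': "M' \<in> carrier_mat (\<Sum>i<N. sub_p (S' i)) q'"
    and Y_def: "Y = W * M * H - W' * M'"
    and Y_nonzero: "Y \<noteq> 0\<^sub>m r q'"
    and \<mu>_pos: "\<And>i. i < N \<Longrightarrow> 0 < \<mu> i"
    and Z: "semidef_le q' (0\<^sub>m q' q') Z"
    and LMI_Z: "semidef_le (q' + q)
      (transpose_mat (four_block_mat Y (W * M) (0\<^sub>m q q') (1\<^sub>m q))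
          * block_X N \<mu> X11 X12 X21 X22
          * four_block_mat Y (W * M) (0\<^sub>m q q') (1\<^sub>m q)
        - four_block_mat Z (0\<^sub>m q' q) (0\<^sub>m q q') (0\<^sub>m q q))
      (0\<^sub>m (q' + q) (q' + q))"
  defines "Vsum \<equiv> \<lambda>x x'. \<Sum>i<N. \<mu> i *
      V i (vec_block (\<lambda>k. sub_n (S k)) i x) (vec_block (\<lambda>k. sub_n (S' k)) i x')"
    and "\<Delta>sum \<equiv> \<lambda>x'. quad_form Z (stacked_h2 N S' x')
      + (\<Sum>i<N. \<mu> i * \<Delta> i (vec_block (\<lambda>k. sub_n (S' k)) i x'))"
  shows "practical_simulation_function (interconnection N S' M') (interconnection N S M) Vsum \<and>
    (\<exists>v \<nu> \<eta> \<rho>. simulation_data (interconnection N S' M') (interconnection N S M) Vsum v \<nu> \<eta> \<rho> \<Delta>sum)"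
proof -
  let ?S = "interconnection N S M" and ?S' = "interconnection N S' M'"
  define n n' m m' p p' where
    dims: "n = (\<lambda>i. sub_n (S i))" "n' = (\<lambda>i. sub_n (S' i))" "m = (\<lambda>i. sub_m (S i))"
      "m' = (\<lambda>i. sub_m (S' i))" "p = (\<lambda>i. sub_p (S i))" "p' = (\<lambda>i. sub_p (S' i))"
  define C C' U' where "C = (carrier_vec (\<Sum>i<N. n i) :: real vec set)"
    and "C' = (carrier_vec (\<Sum>i<N. n' i) :: real vec set)"
    and "U' = (carrier_vec (\<Sum>i<N. m' i) :: real vec set)"
  note st = storage[unfolded practical_storage_function_def Let_def]
  have sub: "control_subsystem (S i)" "control_subsystem (S' i)" "sub_q1 (S' i) = sub_q1 (S i)"
    and CD: "continuously_differentiable (n i) (n' i) (V i)"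
    and lip: "locally_lipschitz_on (carrier_vec (n i) \<times> carrier_vec (n' i) \<times> carrier_vec (m' i))
      (\<lambda>(x, x', u'). v i x x' u')"
    and K: "class_K_inf (\<nu> i)" "class_K_inf (\<eta> i)" "class_K_zero (\<rho> i)"
    and Wc: "Wi i \<in> carrier_mat (dim_row (Wi i)) (p i)"
      "Wi' i \<in> carrier_mat (dim_row (Wi i)) (p' i)"
      "Hi i \<in> carrier_mat (sub_q2 (S i)) (sub_q2 (S' i))"
    and Xc: "X11 i \<in> carrier_mat (dim_row (Wi i)) (dim_row (Wi i))"
      "X12 i \<in> carrier_mat (dim_row (Wi i)) (sub_q2 (S i))"
      "X21 i \<in> carrier_mat (sub_q2 (S i)) (dim_row (Wi i))"
      "X22 i \<in> carrier_mat (sub_q2 (S i)) (sub_q2 (S i))"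
    if "i < N" for i
    using st[OF that] unfolding dims by blast+
  have \<Delta>nn: "0 \<le> \<Delta> i x'" if "i < N" "x' \<in> carrier_vec (n' i)" for i x'
    using st[OF that(1)] that(2) unfolding dims by blast
  have Vnn: "0 \<le> V i x x'"
    and \<nu>: "\<nu> i (vec_norm (sub_h1 (S i) x - sub_h1 (S' i) x')) \<le> V i x x'"
    if "i < N" "x \<in> carrier_vec (n i)" "x' \<in> carrier_vec (n' i)" for i x x'
    using st[OF that(1)] that(2,3) unfolding dims by blast+
  have vc: "v i x x' u' \<in> carrier_vec (m i)"
    if "i < N" "x \<in> carrier_vec (n i)" "x' \<in> carrier_vec (n' i)" "u' \<in> carrier_vec (m' i)"
    for i x x' u'
    using st[OF that(1)] that(2-) unfolding dims by blast
  have diss: "gradient (\<lambda>y. V i y x') x \<bullet> sub_f (S i) x (v i x x' u') w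
      + gradient (\<lambda>y. V i x y) x' \<bullet> sub_f (S' i) x' u' w'
      \<le> - \<eta> i (V i x x') + \<rho> i (vec_norm u') + \<Delta> i x'
        + quad_form (four_block_mat (X11 i) (X12 i) (X21 i) (X22 i))
          ((Wi i *\<^sub>v w - Wi' i *\<^sub>v w') @\<^sub>v (sub_h2 (S i) x - Hi i *\<^sub>v sub_h2 (S' i) x'))"
    if "i < N" "x \<in> carrier_vec (n i)" "x' \<in> carrier_vec (n' i)" "u' \<in> carrier_vec (m' i)"
      "w \<in> carrier_vec (p i)" "w' \<in> carrier_vec (p' i)" for i x x' u' w w'
    using st[OF that(1)] that(2-) unfolding dims by blast
  have f: "sub_f (S i) x u w \<in> carrier_vec (n i)"
    if "i < N" "x \<in> carrier_vec (n i)" "u \<in> carrier_vec (m i)" "w \<in> carrier_vec (p i)" for i x u w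
    using sub(1)[OF that(1)] that(2-) by (simp add: control_subsystem_def dims)
  have f': "sub_f (S' i) x u w \<in> carrier_vec (n' i)"
    if "i < N" "x \<in> carrier_vec (n' i)" "u \<in> carrier_vec (m' i)" "w \<in> carrier_vec (p' i)" for i x u w
    using sub(2)[OF that(1)] that(2-) by (simp add: control_subsystem_def dims)
  have h1: "sub_h1 (S i) x \<in> carrier_vec (sub_q1 (S i))"
      "sub_h2 (S i) x \<in> carrier_vec (sub_q2 (S i))"
    if "i < N" "x \<in> carrier_vec (n i)" for i x
    using sub(1)[OF that(1)] that(2-) by (simp_all add: control_subsystem_def dims)
  have h1': "sub_h1 (S' i) x \<in> carrier_vec (sub_q1 (S i))"
      "sub_h2 (S' i) x \<in> carrier_vec (sub_q2 (S' i))"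
    if "i < N" "x \<in> carrier_vec (n' i)" for i x
    using sub(2,3)[OF that(1)] that(2-) by (simp_all add: control_subsystem_def dims)

  \<comment> \<open>without subsystems \<open>Y\<close> would be the empty matrix, which is a zero matrix\<close>
  have "0 < N"
  proof (rule ccontr)
    assume "\<not> 0 < N"
    then have "W \<in> carrier_mat 0 0" "H \<in> carrier_mat 0 0" "M \<in> carrier_mat 0 0"
        "W' \<in> carrier_mat 0 0" "M' \<in> carrier_mat 0 0"
      using M M' by (auto simp: W_def W'_def H_def q_def q'_def)
    then have "Y = 0\<^sub>m r q'"
      using \<open>\<not> 0 < N\<close> by (auto simp: Y_def r_def q'_def intro!: eq_matI)
    then show False
      using Y_nonzero by simp
  qed

  have Vsum: "Vsum = (\<lambda>x x'. \<Sum>i<N. \<mu> i * V i (vec_block n i x) (vec_block n' i x'))"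
    by (simp add: Vsum_def dims)
  have "class_K_inf (\<lambda>s. \<mu> i * \<nu> i s)" if "i < N" for i
    using class_K_inf_scale[OF K(1) \<mu>_pos, of i i 1] that by simp
  from class_K_inf_sum_lower_bound[of N "\<lambda>i s. \<mu> i * \<nu> i s", OF this \<open>0 < N\<close>]
  obtain \<nu>s where \<nu>s: "class_K_inf \<nu>s"
      "\<And>t. \<forall>i<N. 0 \<le> t i \<Longrightarrow> \<nu>s (\<Sum>i<N. t i) \<le> (\<Sum>i<N. \<mu> i * \<nu> i (t i))"
    by blast
  \<comment> \<open>the argument is rescaled because the bound is used with \<open>t i = \<mu> i * V i\<close>, which sum up to \<open>V\<close>\<close>
  have "class_K_inf (\<lambda>s. \<mu> i * \<eta> i (1 / \<mu> i * s))" if "i < N" for i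
    using class_K_inf_scale[OF K(2) \<mu>_pos, of i i "1 / \<mu> i"] \<mu>_pos that by simp
  from class_K_inf_sum_lower_bound[of N "\<lambda>i s. \<mu> i * \<eta> i (1 / \<mu> i * s)", OF this \<open>0 < N\<close>]
  obtain \<eta>s where \<eta>s: "class_K_inf \<eta>s"
      "\<And>t. \<forall>i<N. 0 \<le> t i \<Longrightarrow> \<eta>s (\<Sum>i<N. t i) \<le> (\<Sum>i<N. \<mu> i * \<eta> i (1 / \<mu> i * t i))"
    by blast
  define \<rho>s where "\<rho>s = (\<lambda>s. \<Sum>i<N. \<mu> i * \<rho> i s)"
  define vs where "vs = (\<lambda>x x' u'. vec_concat N
      (\<lambda>i. v i (vec_block n i x) (vec_block n' i x') (vec_block m' i u')))"

  have output_bound: "\<nu>s (vec_norm (out_map ?S x - out_map ?S' x')) \<le> Vsum x x'" for x x'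
  proof -
    let ?e = "\<lambda>i. sub_h1 (S i) (vec_block n i x) - sub_h1 (S' i) (vec_block n' i x')"
    have "out_map ?S x - out_map ?S' x' = vec_concat N ?e"
      using carrier_vecD[OF h1(1)] carrier_vecD[OF h1'(1)]
      by (simp add: interconnection_def dims[symmetric] Let_def vec_concat_diff)
    then have "\<nu>s (vec_norm (out_map ?S x - out_map ?S' x')) \<le> \<nu>s (\<Sum>i<N. vec_norm (?e i))"
      using \<nu>s(1) vec_norm_vec_concat_le[of N ?e]
      by (simp add: class_K_inf_def class_K_mono vec_norm_nonneg)
    also have "\<dots> \<le> (\<Sum>i<N. \<mu> i * \<nu> i (vec_norm (?e i)))"
      by (intro \<nu>s(2)) (simp add: vec_norm_nonneg)
    also have "\<dots> \<le> Vsum x x'"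
      unfolding Vsum using \<nu> \<mu>_pos by (intro sum_mono mult_left_mono) (auto simp: less_imp_le)
    finally show ?thesis .
  qed

  have dissipation: "gradient (\<lambda>y. Vsum y x') x \<bullet> dynamics ?S x (vs x x' u')
        + gradient (\<lambda>y. Vsum x y) x' \<bullet> dynamics ?S' x' u'
      \<le> - \<eta>s (Vsum x x') + \<rho>s (vec_norm u') + \<Delta>sum x'"
    if x: "x \<in> C" and x': "x' \<in> C'" and u': "u' \<in> U'" for x x' u'
  proof -
    define w where "w = M *\<^sub>v stacked_h2 N S x"
    define w' where "w' = M' *\<^sub>v stacked_h2 N S' x'"
    define X where "X = (\<lambda>i. four_block_mat (X11 i) (X12 i) (X21 i) (X22 i))"
    let ?x = "\<lambda>i. vec_block n i x" and ?x' = "\<lambda>i. vec_block n' i x'"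
      and ?u' = "\<lambda>i. vec_block m' i u'"
      and ?w = "\<lambda>i. vec_block p i w" and ?w' = "\<lambda>i. vec_block p' i w'"
    define s where "s = (\<lambda>i. (Wi i *\<^sub>v ?w i - Wi' i *\<^sub>v ?w' i)
      @\<^sub>v (sub_h2 (S i) (?x i) - Hi i *\<^sub>v sub_h2 (S' i) (?x' i)))"
    have dyn: "dynamics ?S x (vs x x' u')
        = vec_concat N (\<lambda>i. sub_f (S i) (?x i) (v i (?x i) (?x' i) (?u' i)) (?w i))"
      unfolding interconnection_def Let_def dims[symmetric] w_def[symmetric] system.select_convs
      by (intro vec_concat_cong) (simp add: vs_def vc vec_block_vec_concat)
    have dyn': "dynamics ?S' x' u' = vec_concat N (\<lambda>i. sub_f (S' i) (?x' i) (?u' i) (?w' i))"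
      by (simp add: interconnection_def Let_def dims w'_def)
    have "gradient (\<lambda>y. Vsum y x') x \<bullet> dynamics ?S x (vs x x' u') = (\<Sum>i<N. \<mu> i *
        (gradient (\<lambda>y. V i y (?x' i)) (?x i)
          \<bullet> sub_f (S i) (?x i) (v i (?x i) (?x' i) (?u' i)) (?w i)))"
      unfolding Vsum dyn using x f vc CD
      by (intro gradient_block_sum_scalar_prod[where g = "\<lambda>i y. V i y (?x' i)"])
        (auto simp: C_def continuously_differentiable_def)
    moreover have "gradient (\<lambda>y. Vsum x y) x' \<bullet> dynamics ?S' x' u' = (\<Sum>i<N. \<mu> i *
        (gradient (\<lambda>y. V i (?x i) y) (?x' i) \<bullet> sub_f (S' i) (?x' i) (?u' i) (?w' i)))"
      unfolding Vsum dyn' using x' f' CD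
      by (intro gradient_block_sum_scalar_prod[where g = "\<lambda>i y. V i (?x i) y"])
        (auto simp: C'_def continuously_differentiable_def)
    ultimately have "gradient (\<lambda>y. Vsum y x') x \<bullet> dynamics ?S x (vs x x' u')
          + gradient (\<lambda>y. Vsum x y) x' \<bullet> dynamics ?S' x' u'
        = (\<Sum>i<N. \<mu> i *
          (gradient (\<lambda>y. V i y (?x' i)) (?x i)
              \<bullet> sub_f (S i) (?x i) (v i (?x i) (?x' i) (?u' i)) (?w i)
            + gradient (\<lambda>y. V i (?x i) y) (?x' i) \<bullet> sub_f (S' i) (?x' i) (?u' i) (?w' i)))"
      by (simp add: sum.distrib distrib_left)
    also have "\<dots> \<le> (\<Sum>i<N. \<mu> i * (- \<eta> i (V i (?x i) (?x' i)) + \<rho> i (vec_norm (?u' i))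
        + \<Delta> i (?x' i) + quad_form (X i) (s i)))"
      unfolding X_def s_def using \<mu>_pos
      by (intro sum_mono mult_left_mono diss) (auto simp: less_imp_le)
    also have "\<dots> = - (\<Sum>i<N. \<mu> i * \<eta> i (V i (?x i) (?x' i)))
        + (\<Sum>i<N. \<mu> i * \<rho> i (vec_norm (?u' i)))
        + (\<Sum>i<N. \<mu> i * \<Delta> i (?x' i)) + (\<Sum>i<N. \<mu> i * quad_form (X i) (s i))"
      by (simp add: sum.distrib sum_subtractf algebra_simps)
    also have "\<dots> \<le> - \<eta>s (Vsum x x') + \<rho>s (vec_norm u') + (\<Sum>i<N. \<mu> i * \<Delta> i (?x' i))
        + quad_form Z (stacked_h2 N S' x')"
    proof -
      have "\<eta>s (Vsum x x') \<le> (\<Sum>i<N. \<mu> i * \<eta> i (1 / \<mu> i * (\<mu> i * V i (?x i) (?x' i))))"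
        unfolding Vsum using Vnn \<mu>_pos by (intro \<eta>s(2)) (auto simp: less_imp_le)
      also have "\<dots> = (\<Sum>i<N. \<mu> i * \<eta> i (V i (?x i) (?x' i)))"
        using \<mu>_pos by (intro sum.cong) (auto simp: less_imp_neq[symmetric])
      finally have "\<eta>s (Vsum x x') \<le> (\<Sum>i<N. \<mu> i * \<eta> i (V i (?x i) (?x' i)))" .
      moreover have "(\<Sum>i<N. \<mu> i * \<rho> i (vec_norm (?u' i))) \<le> \<rho>s (vec_norm u')"
        unfolding \<rho>s_def
      proof (rule sum_mono)
        fix i assume "i \<in> {..<N}"
        then have "\<rho> i (vec_norm (?u' i)) \<le> \<rho> i (vec_norm u')"
          using u' by (intro class_K_zero_mono[OF K(3)] vec_norm_vec_block_le)
            (auto simp: vec_norm_nonneg U'_def)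
        then show "\<mu> i * \<rho> i (vec_norm (?u' i)) \<le> \<mu> i * \<rho> i (vec_norm u')"
          using \<mu>_pos[of i] \<open>i \<in> {..<N}\<close> by simp
      qed
      moreover have "(\<Sum>i<N. \<mu> i * quad_form (X i) (s i)) \<le> quad_form Z (stacked_h2 N S' x')"
        unfolding X_def s_def stacked_h2_def dims(2)[symmetric]
      proof (rule coupled_supply_bound[OF Wc Xc W_def W'_def H_def Y_def q_def q'_def])
        show "M \<in> carrier_mat (\<Sum>i<N. p i) q" "M' \<in> carrier_mat (\<Sum>i<N. p' i) q'"
          using M M' by (simp_all add: dims)
        show "Z \<in> carrier_mat q' q'"
          using Z by (simp add: semidef_le_def symmetric_mat_def)
        show "w = M *\<^sub>v vec_concat N (\<lambda>i. sub_h2 (S i) (?x i))"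
          "w' = M' *\<^sub>v vec_concat N (\<lambda>i. sub_h2 (S' i) (?x' i))"
          by (simp_all add: w_def w'_def stacked_h2_def dims)
      qed (use LMI_Z h1 h1' in auto)
      ultimately show ?thesis
        by linarith
    qed
    also have "\<dots> = - \<eta>s (Vsum x x') + \<rho>s (vec_norm u') + \<Delta>sum x'"
      by (simp add: \<Delta>sum_def dims)
    finally show ?thesis .
  qed

  have "simulation_data ?S' ?S Vsum vs \<nu>s \<eta>s \<rho>s \<Delta>sum"
  proof -
    have dim_S: "state_dim ?S = (\<Sum>i<N. n i)" "state_dim ?S' = (\<Sum>i<N. n' i)"
      "input_dim ?S = (\<Sum>i<N. m i)" "input_dim ?S' = (\<Sum>i<N. m' i)"
      by (simp_all add: interconnection_def dims Let_def)
    have "control_system ?S'" "control_system ?S"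
      using sub M M' by (auto intro!: control_system_interconnection simp: q_def q'_def)
    moreover have "output_dim ?S' = output_dim ?S"
      using sub(3) by (simp add: interconnection_def Let_def)
    moreover have "continuously_differentiable (\<Sum>i<N. n i) (\<Sum>i<N. n' i) Vsum"
      unfolding Vsum using CD
      by (intro continuously_differentiable_block_sum[where V = "\<lambda>i x x'. \<mu> i * V i x x'"]
          continuously_differentiable_cmult) auto
    moreover have "0 \<le> Vsum x x'" for x x'
      unfolding Vsum using Vnn \<mu>_pos by (intro sum_nonneg) (auto simp: less_imp_le)
    moreover have "vs x x' u' \<in> carrier_vec (\<Sum>i<N. m i)" for x x' u'
      unfolding vs_def using vc by (intro vec_concat_carrier) auto
    moreover have "locally_lipschitz_on (C \<times> C' \<times> U') (\<lambda>(x, x', u'). vs x x' u')"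
      unfolding vs_def C_def C'_def U'_def using lip vc by (rule locally_lipschitz_on_interfaces)
    moreover have "class_K_zero \<rho>s"
      unfolding \<rho>s_def using K(3) \<mu>_pos by (rule class_K_zero_sum)
    moreover have "0 \<le> \<Delta>sum x'" for x'
    proof -
      have Zc: "Z \<in> carrier_mat q' q'"
        using Z by (simp add: semidef_le_def symmetric_mat_def)
      have y: "stacked_h2 N S' x' \<in> carrier_vec q'"
        unfolding q'_def using sub(2) by (rule stacked_h2_carrier)
      have "0 \<le> quad_form (Z - 0\<^sub>m q' q') (stacked_h2 N S' x')"
        using Z y by (simp add: semidef_le_def)
      also have "\<dots> = quad_form Z (stacked_h2 N S' x')"
        using y quad_form_diff[OF Zc zero_carrier_mat y]
        by (simp add: quad_form_def zero_mult_mat_vec)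
      finally have "0 \<le> quad_form Z (stacked_h2 N S' x')" .
      moreover have "0 \<le> (\<Sum>i<N. \<mu> i * \<Delta> i (vec_block n' i x'))"
        using \<Delta>nn \<mu>_pos by (intro sum_nonneg) (auto simp: less_imp_le)
      ultimately show ?thesis
        by (simp add: \<Delta>sum_def dims)
    qed
    ultimately show ?thesis
      using \<nu>s(1) \<eta>s(1) output_bound dissipation
      unfolding simulation_data_def Let_def dim_S
        C_def[symmetric] C'_def[symmetric] U'_def[symmetric]
      by blast
  qed
  then show ?thesis
    unfolding practical_simulation_function_def by blast
qed

end
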